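(* Let $s>k\geqslant 5$ be positive integers with $s>101k^3$, and let $n$ be an integer satisfying $(s+1)k\leqslant n<(s+1)\left(k+\frac{1}{100k}\right)$. Then for every family $\mathcal{F}\subset\binom{[n]}{k}$ with $\nu(\mathcal{F})\leqslant s$ we have $|\mathcal{F}|\leqslant|\mathcal{A}|$, where $\mathcal{A}=\binom{[(s+1)k-1]}{k}$; that is, $|\mathcal{F}|\leqslant\binom{(s+1)k-1}{k}$.
   Context: $[m]=\{1,\ldots,m\}$. For a set $X$, $\binom{X}{k}$ denotes the set of all $k$-element subsets of $X$. A family is a collection of sets, and $\nu(\mathcal{F})$ denotes the matching number of $\mathcal{F}$, i.e. the maximum number of pairwise disjoint sets in $\mathcal{F}$. *)

theory Defs
  imports Complex_Main "HOL-Library.Disjoint_Sets" "HOL-Library.Ramsey"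
begin

text \<open>
  The maximum below is meaningful for finite families only: for these the set of sizes is
  finite, and it contains 0 because of the empty subfamily.
\<close>
definition matching_number :: "'a set set \<Rightarrow> nat" where
  "matching_number F = Max {card M | M. M \<subseteq> F \<and> disjoint M}"

end

theory Submission
  imports Defs
begin

text \<open>
  Let $N = s + 1$ and $m = kN - 1$. Shifting makes $F$ shifted. For a shifted family the density of
  the link of $x$ decreases in $x$, so with $\beta$ the density of the link of $m + 1$ in
  $\binom{[m]}{k-1}$, a family with more than $\binom{m}{k}$ sets misses a proportion of less
  than $\beta / (50 k)$ of $\binom{[m]}{k}$. This forces a perfect matching of $[kN]$, by a
  switching argument in the spirit of Daykin and Haggkvist: a partition of $[kN]$ into $k$-sets can be
  changed into a perfect matching as soon as in each of its parts $S$ the proportions $w(x)$ of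
  missing sets through $x \in S$ sum up to less than $1 - k^2/(2N)$. Since $w \le 1 - \beta$
  everywhere and the average of $kw$ is at most about $\beta/50$, a partition
  balanced with respect to $w$ has this property when $\beta \ge k^2/N$. When
  $\beta < k^2/N$, the few vertices $x$ with $w(x) \ge 1/2$ are first covered by disjoint
  sets from the link.
\<close>

section \<open>Switching in uniform partitions\<close>

text \<open>The obstacle is that the gap \<open>\<beta>\<close> is the only slack. The last vertex
  of \<open>[k N]\<close> misses exactly the proportion \<open>1 - \<beta>\<close> of its sets, so a
  part through it leaves just \<open>\<beta>\<close> for the missing sets at its other vertices and
  for the shortfall of about \<open>k^2 / (2 N)\<close> between transversals and all
  \<open>k\<close>-sets through a vertex. If \<open>\<beta> \<ge> k^2 / N\<close>, half of
  \<open>\<beta>\<close> covers this shortfall and balancing keeps the rest small. A smaller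
  \<open>\<beta>\<close>, possibly coming from a single set in the link, cannot pay for it. But then
  few sets are missing: measured in full degrees, the missing degrees in \<open>[m]\<close> add up
  to less than \<open>\<beta> N / 50\<close>, so fewer than \<open>\<beta> N / 25\<close> vertices
  miss half of their sets, while the link contains about \<open>\<beta> N\<close> disjoint sets to
  cover them.

  The factor \<open>1 / (50 k)\<close> comes from the range of \<open>n\<close>: \<open>n\<close>
  exceeds \<open>m\<close> by a proportion of about \<open>1 / (100 k^2)\<close> at most, hence
  \<open>n choose k\<close> exceeds \<open>m choose k\<close> by about \<open>1 / (100 k)\<close>; a
  factor of two is kept for lower-order terms.\<close>

lemma cyclic_rotations:
  assumes "finite E" "card E = k"
  shows "\<exists>r. (\<forall>i<k. bij_betw (r i) E E) \<and> (\<forall>x\<in>E. bij_betw (\<lambda>i. r i x) {..<k} E)"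
proof -
  obtain e where e: "bij_betw e {..<k} E"
    using ex_bij_betw_nat_finite[OF assms(1)] assms(2) by (auto simp: atLeast0LessThan)
  define g where "g = inv_into {..<k} e"
  have g: "bij_betw g E {..<k}" using e by (simp add: g_def bij_betw_inv_into)
  have add: "bij_betw (\<lambda>x. (x + i) mod k) {..<k} {..<k}" if "i < k" for i :: nat
  proof -
    have "inj_on (\<lambda>x. (x + i) mod k) {..<k}"
      using that by (auto simp: inj_on_def mod_if split: if_splits)
    moreover have "(\<lambda>x. (x + i) mod k) ` {..<k} \<subseteq> {..<k}" using that by auto
    ultimately show ?thesis by (simp add: bij_betw_def endo_inj_surj)
  qed
  have "bij_betw (\<lambda>x. e ((g x + i) mod k)) E E" if "i < k" for i
    using bij_betw_trans[OF bij_betw_trans[OF g add[OF that]] e] by (simp add: o_def)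
  moreover have "bij_betw (\<lambda>i. e ((g x + i) mod k)) {..<k} E" if "x \<in> E" for x
  proof -
    have "g x < k" using g that by (auto simp: bij_betw_def)
    from bij_betw_trans[OF add[OF this] e] show ?thesis by (simp add: o_def add.commute)
  qed
  ultimately show ?thesis
    by (intro exI[of _ "\<lambda>i x. e ((g x + i) mod k)"]) blast
qed

text \<open>Glues the rotations of the single parts into global maps. That each orbit runs exactly
  once through its part is what later makes the rotated copies of a transversal tile the parts it
  meets.\<close>

lemma rotations_within_parts:
  assumes "partition_on V P" "\<forall>E\<in>P. finite E \<and> card E = k"
  obtains \<rho> where "\<And>i E. i < k \<Longrightarrow> E \<in> P \<Longrightarrow> bij_betw (\<rho> i) E E"
    and "\<And>x E. E \<in> P \<Longrightarrow> x \<in> E \<Longrightarrow> bij_betw (\<lambda>i. \<rho> i x) {..<k} E"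
proof -
  have "\<forall>E\<in>P. \<exists>r. (\<forall>i<k. bij_betw (r i) E E) \<and> (\<forall>x\<in>E. bij_betw (\<lambda>i. r i x) {..<k} E)"
    using assms(2) by (auto intro!: cyclic_rotations)
  then obtain r where r: "\<forall>E\<in>P. (\<forall>i<k. bij_betw (r E i) E E) \<and> (\<forall>x\<in>E. bij_betw (\<lambda>i. r E i x) {..<k} E)"
    by metis
  define \<rho> where "\<rho> i x = r (THE E. E \<in> P \<and> x \<in> E) i x" for i x
  have the: "(THE E. E \<in> P \<and> x \<in> E) = E" if "E \<in> P" "x \<in> E" for x E
    using that partition_onD2[OF assms(1)] by (intro the_equality) (auto simp: disjoint_def)
  have eq: "\<rho> i x = r E i x" if "E \<in> P" "x \<in> E" for x E i
    using the[OF that] by (simp add: \<rho>_def)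
  show ?thesis
  proof (rule that[of \<rho>])
    show "bij_betw (\<rho> i) E E" if "i < k" "E \<in> P" for i E
      using r that eq[OF that(2)] by (subst bij_betw_cong[of E _ "r E i"]) auto
    show "bij_betw (\<lambda>i. \<rho> i x) {..<k} E" if "E \<in> P" "x \<in> E" for x E
      using r that eq[OF that] by simp
  qed
qed

definition transversals :: "'a set set \<Rightarrow> nat \<Rightarrow> 'a set set" where
  "transversals P r = {X. X \<subseteq> \<Union>P \<and> finite X \<and> card X = r \<and> (\<forall>E\<in>P. card (X \<inter> E) \<le> 1)}"

lemma finite_transversals: "finite (\<Union>P) \<Longrightarrow> finite (transversals P r)"
  by (rule finite_subset[of _ "Pow (\<Union>P)"]) (auto simp: transversals_def)

text \<open>Choose the \<open>r\<close> parts that are hit and one of \<open>k\<close> points in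
  each. The induction is Pascal's rule: a transversal avoids the new part \<open>E\<close>
  (\<open>?A\<close>) or has one point in it (\<open>?B\<close>).\<close>

lemma card_transversals_ge:
  assumes "finite P" "disjoint P" "\<forall>E\<in>P. finite E \<and> card E = k"
  shows "(card P choose r) * k ^ r \<le> card (transversals P r)"
  using assms
proof (induction P arbitrary: r rule: finite_induct)
  case empty
  show ?case
  proof (cases r)
    case 0
    then have "transversals ({} :: 'a set set) r = {{}}" by (auto simp: transversals_def)
    then have "card (transversals ({} :: 'a set set) 0) = 1" unfolding 0 by simp
    then show ?thesis by (simp add: 0)
  qed simp
next
  case (insert E P)
  have disj: "disjoint P" and E: "finite E" "card E = k" "E \<inter> \<Union>P = {}"
    using insert by (auto simp: disjoint_def)
  have finU: "finite (\<Union>P)" "finite (\<Union>(insert E P))" using insert by auto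
  have IH: "(card P choose r) * k ^ r \<le> card (transversals P r)" for r
    using insert disj by auto
  show ?case
  proof (cases r)
    case 0
    have "{} \<in> transversals (insert E P) 0" by (auto simp: transversals_def)
    then have "0 < card (transversals (insert E P) 0)"
      using finite_transversals[OF finU(2)] card_gt_0_iff by blast
    then show ?thesis using 0 by simp
  next
    case (Suc q)
    let ?A = "transversals P (Suc q)" and ?B = "(\<lambda>(x, X). insert x X) ` (E \<times> transversals P q)"
    have notin: "X \<inter> E = {}" if "X \<in> transversals P i" for X i
      using that E(3) by (auto simp: transversals_def)
    have "?A \<subseteq> transversals (insert E P) (Suc q)"
    proof
      fix X assume X: "X \<in> ?A"
      then show "X \<in> transversals (insert E P) (Suc q)"
        using notin[OF X] by (auto simp: transversals_def)
    qed
    moreover have "?B \<subseteq> transversals (insert E P) (Suc q)"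
    proof clarify
      fix x X assume x: "x \<in> E" and X: "X \<in> transversals P q"
      have "insert x X \<inter> E = {x}" using x notin[OF X] by auto
      moreover have "insert x X \<inter> E' = X \<inter> E'" if "E' \<in> P" for E' using x that E(3) by auto
      ultimately show "insert x X \<in> transversals (insert E P) (Suc q)"
        using x X notin[OF X] by (auto simp: transversals_def card_insert_if)
    qed
    moreover have "?A \<inter> ?B = {}" using notin by fastforce
    moreover have "card ?B = k * card (transversals P q)"
    proof -
      have "inj_on (\<lambda>(x, X). insert x X) (E \<times> transversals P q)"
      proof (rule inj_onI, clarify)
        fix x X y Y assume *: "x \<in> E" "X \<in> transversals P q" "y \<in> E" "Y \<in> transversals P q"
          "insert x X = insert y Y"
        then have "insert x X \<inter> E = {x}" "insert y Y \<inter> E = {y}"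
          "insert x X - E = X" "insert y Y - E = Y"
          using notin[OF *(2)] notin[OF *(4)] by auto
        then show "x = y \<and> X = Y" using *(5) by auto
      qed
      then show ?thesis by (simp add: card_image card_cartesian_product E)
    qed
    moreover have "finite ?A" "finite ?B" "finite (transversals (insert E P) (Suc q))"
      using finite_transversals[OF finU(1)] finite_transversals[OF finU(2)] E(1) by auto
    ultimately have "card ?A + k * card (transversals P q) \<le> card (transversals (insert E P) (Suc q))"
      by (metis card_Un_disjoint card_mono Un_least)
    moreover have "(card (insert E P) choose Suc q) * k ^ Suc q
        = (card P choose Suc q) * k ^ Suc q + k * ((card P choose q) * k ^ q)"
      using insert by (simp add: algebra_simps)
    ultimately show ?thesis using IH[of "Suc q"] mult_le_mono2[OF IH[of q], of k] unfolding Suc by linarith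
  qed
qed

definition deg :: "'a set set \<Rightarrow> 'a \<Rightarrow> nat" where
  "deg H x = card {A \<in> H. x \<in> A}"

lemma deg_mono:
  assumes "H \<subseteq> H'" "finite H'"
  shows "deg H x \<le> deg H' x"
  unfolding deg_def by (rule card_mono[OF finite_subset[of _ H']]) (use assms in auto)

lemma sum_deg:
  assumes "finite V" "H \<subseteq> nsets V k"
  shows "(\<Sum>x\<in>V. deg H x) = k * card H"
  unfolding deg_def
proof (rule sum_multicount)
  show "finite H" using assms finite_imp_finite_nsets finite_subset by blast
  show "\<forall>A\<in>H. card {x \<in> V. x \<in> A} = k"
  proof
    fix A assume "A \<in> H"
    then have "{x \<in> V. x \<in> A} = A" "card A = k" using assms by (auto simp: nsets_def)
    then show "card {x \<in> V. x \<in> A} = k" by simp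
  qed
qed (fact assms)

text \<open>
  The switch: let $\rho_i$ rotate every part cyclically by $i$ steps, and let $T$ be a transversal
  through a vertex of the bad part $S$ that meets $k - 1$ further parts. The sets $\rho_i(T)$
  with $i < k$ partition the union of the $k$ parts met by $T$. Each of them contains exactly one
  vertex $x$ of $S$, and the choices of $T$ that spoil it are at most as many as the missing sets through $x$.
\<close>
lemma switch_bad_part:
  assumes fin: "finite V" and P: "partition_on V P" and k: "\<forall>E\<in>P. card E = k"
    and S: "S \<in> P"
    and less: "(\<Sum>x\<in>S. deg (nsets V k - G) x) < (card P - 1 choose (k - 1)) * k ^ (k - 1)"
  obtains P' where "partition_on V P'" "\<forall>E\<in>P'. card E = k" "P' - G \<subseteq> P - G - {S}"
proof -
  have finE: "finite E" if "E \<in> P" for E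
    using that partition_onD1[OF P] fin finite_subset[of E V] by auto
  have V: "\<Union>P = V" and disj: "\<And>E E' x. E \<in> P \<Longrightarrow> E' \<in> P \<Longrightarrow> x \<in> E \<Longrightarrow> x \<in> E' \<Longrightarrow> E = E'"
    using partition_onD1[OF P] partition_onD2[OF P] by (auto simp: disjoint_def)
  have "0 < k" using S k finE partition_onD3[OF P] by (metis card_gt_0_iff)
  have finP: "finite P" using finite_elements[OF fin P] .
  obtain \<rho> where \<rho>: "\<And>i E. i < k \<Longrightarrow> E \<in> P \<Longrightarrow> bij_betw (\<rho> i) E E"
    and orbit: "\<And>x E. E \<in> P \<Longrightarrow> x \<in> E \<Longrightarrow> bij_betw (\<lambda>i. \<rho> i x) {..<k} E"
    using rotations_within_parts[OF P, of k] k finE by metis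
  have mem: "\<rho> i x \<in> E \<longleftrightarrow> x \<in> E" if iEx: "i < k" "E \<in> P" "x \<in> V" for i x E
  proof -
    obtain E' where "E' \<in> P" "x \<in> E'" using iEx V by auto
    moreover from this have "\<rho> i x \<in> E'" using \<rho>[OF iEx(1)] by (auto simp: bij_betw_def)
    ultimately show ?thesis using disj iEx by metis
  qed
  have inj: "inj_on (\<rho> i) V" if "i < k" for i
  proof (rule inj_onI)
    fix x y assume xy: "x \<in> V" "y \<in> V" "\<rho> i x = \<rho> i y"
    then obtain E where "E \<in> P" "x \<in> E" using V by auto
    with xy mem[OF that] have "y \<in> E" by metis
    with xy \<rho>[OF that \<open>E \<in> P\<close>] \<open>x \<in> E\<close> show "x = y" by (auto simp: bij_betw_def inj_on_def)
  qed
  have maps: "\<rho> i x \<in> V" if "i < k" "x \<in> V" for i x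
    using that mem[OF that(1) _ that(2)] V by blast
  obtain v where v: "v \<in> S" using S partition_onD3[OF P] by (metis ex_in_conv)
  \<comment> \<open>The members of \<open>Tr\<close> omit the fixed vertex \<open>v\<close> and live
    on the other \<open>card P - 1\<close> parts, which is where the binomial in \<open>less\<close>
    comes from.\<close>
  define Tr where "Tr = transversals (P - {S}) (k - 1)"
  have Tr: "X \<subseteq> V - S" "finite X" "card X = k - 1" "\<And>E. E \<in> P \<Longrightarrow> card (insert v X \<inter> E) \<le> 1"
    if "X \<in> Tr" for X
  proof -
    have X: "X \<subseteq> \<Union>(P - {S})" "\<forall>E\<in>P - {S}. card (X \<inter> E) \<le> 1"
      using that by (auto simp: Tr_def transversals_def)
    then show sub: "X \<subseteq> V - S" using V disj S by blast
    show "finite X" "card X = k - 1" using that by (auto simp: Tr_def transversals_def)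
    fix E assume E: "E \<in> P"
    show "card (insert v X \<inter> E) \<le> 1"
    proof (cases "E = S")
      case True
      then have "insert v X \<inter> E = {v}" using v sub by auto
      then show ?thesis by simp
    next
      case False
      then have "insert v X \<inter> E = X \<inter> E" using v S E disj by auto
      then show ?thesis using X E False by simp
    qed
  qed
  have "finite Tr" unfolding Tr_def by (rule finite_transversals, rule finite_subset[OF _ fin]) (use V in auto)
  define bad where "bad i = {X \<in> Tr. \<rho> i ` insert v X \<notin> G}" for i
  have vV: "v \<in> V" using v S V by auto
  have "card (bad i) \<le> deg (nsets V k - G) (\<rho> i v)" if i: "i < k" for i
    unfolding deg_def
  proof (rule card_inj_on_le)
    show "inj_on (\<lambda>X. \<rho> i ` insert v X) (bad i)"
    proof (rule inj_onI)
      fix X Y assume "X \<in> bad i" "Y \<in> bad i" and eq: "\<rho> i ` insert v X = \<rho> i ` insert v Y"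
      then have XY: "X \<subseteq> V - S" "Y \<subseteq> V - S" using Tr by (auto simp: bad_def)
      then have "insert v X = insert v Y"
        using inj_on_image_eq_iff[OF inj[OF i], of "insert v X" "insert v Y"] eq vV by blast
      moreover have "v \<notin> X" "v \<notin> Y" using XY v by auto
      ultimately show "X = Y" by (simp add: insert_ident)
    qed
    show "(\<lambda>X. \<rho> i ` insert v X) ` bad i \<subseteq> {A \<in> nsets V k - G. \<rho> i v \<in> A}"
    proof clarify
      fix X assume X: "X \<in> bad i"
      then have XT: "X \<in> Tr" by (simp add: bad_def)
      have sub: "insert v X \<subseteq> V" using Tr(1)[OF XT] vV by auto
      have "card (\<rho> i ` insert v X) = card (insert v X)"
        using card_image[OF inj_on_subset[OF inj[OF i] sub]] .
      moreover have "v \<notin> X" using Tr(1)[OF XT] v by auto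
      then have "card (insert v X) = k" using Tr(2,3)[OF XT] \<open>0 < k\<close> by simp
      moreover have "\<rho> i ` insert v X \<subseteq> V" using sub maps[OF i] by blast
      moreover have "finite (\<rho> i ` insert v X)" using Tr(2)[OF XT] by simp
      ultimately show "\<rho> i ` insert v X \<in> nsets V k - G \<and> \<rho> i v \<in> \<rho> i ` insert v X"
        using X by (auto simp: bad_def nsets_def)
    qed
    show "finite {A \<in> nsets V k - G. \<rho> i v \<in> A}"
      using finite_imp_finite_nsets[OF fin] by auto
  qed
  then have "(\<Sum>i<k. card (bad i)) \<le> (\<Sum>i<k. deg (nsets V k - G) (\<rho> i v))"
    by (intro sum_mono) auto
  \<comment> \<open>The rotations carry \<open>v\<close> to every vertex of \<open>S\<close> exactly
    once.\<close>
  also have "\<dots> = (\<Sum>x\<in>S. deg (nsets V k - G) x)"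
    using sum.reindex_bij_betw[OF orbit[OF S v]] .
  also note less
  also have "(card P - 1 choose (k - 1)) * k ^ (k - 1) \<le> card Tr"
    using card_transversals_ge[of "P - {S}" k "k - 1"] finP partition_onD2[OF P] k finE S
    by (auto simp: Tr_def disjoint_def)
  finally have "card (\<Union>i<k. bad i) < card Tr"
    using card_UN_le[of "{..<k}" bad] by simp
  moreover have "finite (\<Union>i<k. bad i)" using \<open>finite Tr\<close> by (auto simp: bad_def)
  ultimately have "\<not> Tr \<subseteq> (\<Union>i<k. bad i)"
    using card_mono[of "\<Union>i<k. bad i" Tr] by linarith
  then obtain X where X: "X \<in> Tr" and "X \<notin> (\<Union>i<k. bad i)" by blast
  then have good: "\<rho> i ` insert v X \<in> G" if "i < k" for i using that by (auto simp: bad_def)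
  define T where "T = insert v X"
  have "v \<notin> X" using Tr(1)[OF X] v by auto
  then have T: "T \<subseteq> V" "v \<in> T" "card T = k"
    using Tr(1-3)[OF X] vV \<open>0 < k\<close> by (auto simp: T_def)
  have uniq: "x = y" if "x \<in> T" "y \<in> T" "x \<in> E" "y \<in> E" "E \<in> P" for x y E
        using Tr(4)[OF X that(5)] that(1-4) finE[OF that(5)] card_le_Suc0_iff_eq[of "T \<inter> E"]
    by (simp add: T_def)
  \<comment> \<open>Only the parts met by \<open>T\<close> are rebuilt, \<open>S\<close> among them
    because \<open>v\<close> lies in \<open>T\<close>. All new parts belong to \<open>G\<close>, so
    no bad part is created and \<open>S\<close> disappears.\<close>
  define P' where "P' = {E \<in> P. E \<inter> T = {}} \<union> (\<lambda>i. \<rho> i ` T) ` {..<k}"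
  show ?thesis
  proof (rule that[of P'])
    have "\<Union>P' = V"
    proof
      have "\<rho> i ` T \<subseteq> V" if "i < k" for i using maps[OF that] T(1) by blast
      then show "\<Union>P' \<subseteq> V" using V unfolding P'_def by blast
      show "V \<subseteq> \<Union>P'"
      proof
        fix y assume "y \<in> V"
        then obtain E where E: "E \<in> P" "y \<in> E" using V by auto
        show "y \<in> \<Union>P'"
        proof (cases "E \<inter> T = {}")
          case False
          then obtain x where x: "x \<in> E" "x \<in> T" by auto
          then obtain i where "i < k" "y = \<rho> i x"
            using orbit[OF E(1) x(1)] E(2) by (auto simp: bij_betw_def)
          then show ?thesis using x by (auto simp: P'_def)
        qed (use E in \<open>auto simp: P'_def\<close>)
      qed
    qed
    moreover have "disjoint P'"
    proof (rule disjointI)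
      have *: "E \<inter> \<rho> i ` T = {}" if "E \<in> P" "E \<inter> T = {}" "i < k" for E i
        using that mem T(1) by blast
      have **: "\<rho> i ` T \<inter> \<rho> j ` T = {}" if ij: "i < k" "j < k" "i \<noteq> j" for i j
      proof -
        have False if xy: "x \<in> T" "y \<in> T" "\<rho> i x = \<rho> j y" for x y
        proof -
          obtain E where E: "E \<in> P" "x \<in> E" using xy T(1) V by auto
          then have "y \<in> E" using mem[OF ij(1), of E x] mem[OF ij(2), of E y] xy T(1) by auto
          then have "x = y" using uniq xy E by blast
          then show False using orbit[OF E] xy(3) ij by (auto simp: bij_betw_def inj_on_def)
        qed
        then show ?thesis by blast
      qed
      fix A B assume "A \<in> P'" "B \<in> P'" "A \<noteq> B"
      then consider "A \<in> P" "B \<in> P"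
        | i where "A \<in> P" "A \<inter> T = {}" "i < k" "B = \<rho> i ` T"
        | i where "B \<in> P" "B \<inter> T = {}" "i < k" "A = \<rho> i ` T"
        | i j where "i < k" "j < k" "A = \<rho> i ` T" "B = \<rho> j ` T" "i \<noteq> j"
        unfolding P'_def by blast
      then show "A \<inter> B = {}"
      proof cases
        case 1
        then show ?thesis using disj \<open>A \<noteq> B\<close> by auto
      next
        case 3
        then show ?thesis using * by (simp add: Int_commute)
      qed (use * ** in simp_all)
    qed
    moreover have "{} \<notin> P'" using partition_onD3[OF P] T(2) by (auto simp: P'_def)
    ultimately show "partition_on V P'" by (simp add: partition_on_def)
    show "\<forall>E\<in>P'. card E = k"
      using k T(3) card_image[OF inj_on_subset[OF inj T(1)]] by (auto simp: P'_def)
    show "P' - G \<subseteq> P - G - {S}"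
      using good v T(2) by (auto simp: P'_def T_def)
  qed
qed

lemma card_uniform_partition:
  assumes "finite V" "partition_on V P" "\<forall>E\<in>P. card E = k" "card V = k * N" "0 < k"
  shows "card P = N"
proof -
  have finE: "finite E" if "E \<in> P" for E
    using that partition_onD1[OF assms(2)] finite_subset[OF _ assms(1)] by blast
  have "card V = (\<Sum>E\<in>P. card E)"
    using partition_onD1[OF assms(2)] card_Union_disjoint[OF partition_onD2[OF assms(2)] finE] by simp
  also have "\<dots> = k * card P" using assms(3) by simp
  finally show ?thesis using assms(4,5) by simp
qed

text \<open>Each switch removes a bad part and creates none. Hence the degree condition, imposed
  only on the bad parts of the initial partition, survives all switches.\<close>

lemma perfect_matching_by_switching:
  assumes "finite V" "partition_on V P" "\<forall>E\<in>P. card E = k" "card V = k * N"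
    and "\<forall>S\<in>P - G. (\<Sum>x\<in>S. deg (nsets V k - G) x) < (N - 1 choose (k - 1)) * k ^ (k - 1)"
  shows "\<exists>P'. partition_on V P' \<and> (\<forall>E\<in>P'. card E = k) \<and> P' \<subseteq> G"
  using assms
proof (induction "card (P - G)" arbitrary: P rule: less_induct)
  case less
  have finP: "finite P" using finite_elements[OF less.prems(1,2)] .
  show ?case
  proof (cases "P \<subseteq> G")
    case False
    then obtain S where S: "S \<in> P" "S \<notin> G" by auto
    have "finite S"
      using S(1) partition_onD1[OF less.prems(2)] finite_subset[OF _ less.prems(1)] by blast
    moreover have "S \<noteq> {}" using S(1) partition_onD3[OF less.prems(2)] by metis
    ultimately have "0 < k" using less.prems(3) S(1) by (metis card_gt_0_iff)
    then have N: "card P = N" using card_uniform_partition[OF less.prems(1-4)] by simp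
    obtain P' where P': "partition_on V P'" "\<forall>E\<in>P'. card E = k" "P' - G \<subseteq> P - G - {S}"
      using switch_bad_part[OF less.prems(1,2,3) S(1), of G] less.prems(5) S unfolding N by blast
    have "card (P' - G) < card (P - G)"
      by (rule psubset_card_mono) (use P'(3) S finP in auto)
    moreover have "\<forall>S\<in>P' - G. (\<Sum>x\<in>S. deg (nsets V k - G) x) < (N - 1 choose (k - 1)) * k ^ (k - 1)"
      using less.prems(5) P'(3) by blast
    ultimately show ?thesis
      using less.hyps[of P'] P'(1,2) less.prems(1,4) by simp
  qed (use less.prems in blast)
qed

section \<open>Balanced partitions and matchings of given density\<close>

lemma card_nsets: "finite A \<Longrightarrow> card (nsets A k) = card A choose k"
proof -
  assume "finite A"
  then have "nsets A k = {B. B \<subseteq> A \<and> card B = k}" by (auto simp: nsets_def intro: finite_subset)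
  then show ?thesis using n_subsets[OF \<open>finite A\<close>] by simp
qed

text \<open>
  Sort $V$ by $u$ and take the parts $\{i, N + i, 2N + i, \ldots\}$: except for the last one, each
  element of a part is dominated by the average of $u$ over the next $N$ positions.
\<close>
lemma balanced_partition:
  fixes u :: "'a \<Rightarrow> nat"
  assumes fin: "finite V" and card: "card V = k * N" and "0 < k" "0 < N"
    and M: "\<And>x. x \<in> V \<Longrightarrow> u x \<le> M"
  obtains P where "partition_on V P" "\<forall>S\<in>P. card S = k"
    and "\<forall>S\<in>P. N * (\<Sum>x\<in>S. u x) \<le> N * M + (\<Sum>x\<in>V. u x)"
proof -
  obtain ys where ys: "set ys = V" "distinct ys" using finite_distinct_list[OF fin] by auto
  define xs where "xs = sort_key u ys"
  have xs: "set xs = V" "distinct xs" "length xs = k * N"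
    using ys card distinct_card[of ys] by (auto simp: xs_def)
  have mono: "u (xs ! a) \<le> u (xs ! b)" if "a \<le> b" "b < k * N" for a b
    using sorted_nth_mono[of "map u xs" a b] that xs(3) by (simp add: xs_def)
  have bij: "bij_betw ((!) xs) {..<k * N} V" using bij_betw_nth[OF xs(2) _ xs(1)[symmetric]] xs(3) by simp
  have idx: "i + j * N < k * N" if "i < N" "j < k" for i j
  proof -
    have "i + j * N < (j + 1) * N" using that by simp
    also have "\<dots> \<le> k * N" using that by (intro mult_le_mono1) simp
    finally show ?thesis .
  qed
  define part where "part i = (\<lambda>j. xs ! (i + j * N)) ` {..<k}" for i
  have inj: "i = i' \<and> j = j'" if "xs ! (i + j * N) = xs ! (i' + j' * N)" "i < N" "j < k" "i' < N" "j' < k" for i j i' j'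
  proof -
    have "i + j * N = i' + j' * N"
      using that idx bij by (auto simp: bij_betw_def inj_on_def)
    then have "(i + j * N) mod N = (i' + j' * N) mod N" "(i + j * N) div N = (i' + j' * N) div N"
      by simp_all
    then show ?thesis using that by simp
  qed
  have injp: "inj_on (\<lambda>j. xs ! (i + j * N)) {..<k}" if "i < N" for i
    using inj that by (auto simp: inj_on_def)
  have "partition_on V (part ` {..<N})"
  proof (rule partition_onI)
    show "\<Union>(part ` {..<N}) = V"
    proof
      show "\<Union>(part ` {..<N}) \<subseteq> V"
        using idx bij unfolding part_def by (auto simp: bij_betw_def)
      show "V \<subseteq> \<Union>(part ` {..<N})"
      proof
        fix x assume "x \<in> V"
        then obtain b where b: "b < k * N" "x = xs ! b" using bij by (auto simp: bij_betw_def)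
        then have "x = xs ! (b mod N + b div N * N)" by simp
        moreover have "b div N < k" using b by (simp add: less_mult_imp_div_less)
        ultimately show "x \<in> \<Union>(part ` {..<N})"
          unfolding part_def using \<open>0 < N\<close>
          by (intro UN_I[of "b mod N"] image_eqI[of _ _ "b div N"]) auto
      qed
    qed
    show "disjnt p q" if pq: "p \<in> part ` {..<N}" "q \<in> part ` {..<N}" "p \<noteq> q" for p q
    proof -
      obtain i i' where "i < N" "i' < N" "p = part i" "q = part i'" "i \<noteq> i'" using pq by auto
      then show ?thesis using inj by (fastforce simp: disjnt_iff part_def)
    qed
    show "{} \<notin> part ` {..<N}" using \<open>0 < k\<close> by (auto simp: part_def)
  qed
  moreover have "\<forall>S\<in>part ` {..<N}. card S = k"
    using card_image[OF injp] by (auto simp: part_def)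
  moreover have "N * (\<Sum>x\<in>part i. u x) \<le> N * M + (\<Sum>x\<in>V. u x)" if i: "i < N" for i
  proof -
    obtain k' where k': "k = Suc k'" using \<open>0 < k\<close> by (cases k) auto
    define w where "w b = u (xs ! b)" for b
    have sumV: "(\<Sum>x\<in>V. u x) = (\<Sum>b<k * N. w b)"
      using sum.reindex_bij_betw[OF bij, of u] by (simp add: w_def)
    have "(\<Sum>x\<in>part i. u x) = (\<Sum>j<k. w (i + j * N))"
      unfolding part_def w_def by (subst sum.reindex[OF injp[OF i]]) simp
    also have "\<dots> \<le> (\<Sum>j<k'. w (i + j * N)) + M"
    proof -
      have "xs ! (i + k' * N) \<in> V" using idx[OF i, of k'] bij k' by (auto simp: bij_betw_def)
      then show ?thesis using M unfolding k' w_def by simp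
    qed
    finally have "N * (\<Sum>x\<in>part i. u x) \<le> N * ((\<Sum>j<k'. w (i + j * N)) + M)" by simp
    also have "\<dots> = (\<Sum>j<k'. \<Sum>b\<in>{j * N..<j * N + N}. w (i + j * N)) + N * M"
      by (simp add: algebra_simps sum_distrib_left)
    also have "(\<Sum>j<k'. \<Sum>b\<in>{j * N..<j * N + N}. w (i + j * N))
        \<le> (\<Sum>j<k'. \<Sum>b\<in>{j * N..<j * N + N}. w (i + b))"
    proof (intro sum_mono)
      fix j b assume jb: "j \<in> {..<k'}" "b \<in> {j * N..<j * N + N}"
      have "b < (j + 1) * N" using jb by simp
      also have "\<dots> \<le> k' * N" using jb by (intro mult_le_mono1) simp
      finally show "w (i + j * N) \<le> w (i + b)"
        unfolding w_def using jb i k' by (intro mono) auto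
    qed
    also have "(\<Sum>j<k'. \<Sum>b\<in>{j * N..<j * N + N}. w (i + b)) = (\<Sum>b<k' * N. w (i + b))"
      by (rule sum.nat_group)
    also have "\<dots> = (\<Sum>b\<in>(\<lambda>b. i + b) ` {..<k' * N}. w b)"
      by (subst sum.reindex) auto
    \<comment> \<open>The windows of length \<open>N\<close> are consecutive and start at position
      \<open>i\<close>; since \<open>i < N\<close>, the last of them ends before position
      \<open>k * N\<close>.\<close>
    also have "\<dots> \<le> (\<Sum>b<k * N. w b)"
      using i k' by (intro sum_mono2) auto
    finally show ?thesis using sumV by simp
  qed
  ultimately show ?thesis using that[of "part ` {..<N}"] by blast
qed

text \<open>
  A random collection of $Q$ disjoint $r$-sets has on average $Q$ times the density of $H$ many
  members in $H$; the induction chooses these sets one by one.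
\<close>
lemma matching_ge_density:
  assumes "finite V" "H \<subseteq> nsets V r" "0 < r" "r * Q \<le> card V"
  shows "\<exists>M\<subseteq>H. disjoint M \<and> Q * card H \<le> card M * (card V choose r)"
  using assms
proof (induction Q arbitrary: V H)
  case 0
  show ?case by (intro exI[of _ "{}"]) auto
next
  case (Suc Q)
  note fin = Suc.prems(1)
  have finH: "finite H" using Suc.prems(1,2) finite_imp_finite_nsets finite_subset by blast
  have HV: "B \<subseteq> V" "finite B" "card B = r" if "B \<in> H" for B using that Suc.prems(2) by (auto simp: nsets_def)
  define C C' where "C = card V choose r" and "C' = card V - r choose r"
  show ?case
  \<comment> \<open>For \<open>Q = 0\<close> a single member of \<open>H\<close> suffices. Otherwise
    \<open>2 * r \<le> card V\<close>, so that \<open>C'\<close> is positive and can be cancelled at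
    the end.\<close>
  proof (cases "Q = 0 \<or> H = {}")
    case True
    show ?thesis
    proof (cases "H = {}")
      case False
      then obtain A where "A \<in> H" by auto
      moreover have "card H \<le> card V choose r"
        using card_mono[OF finite_imp_finite_nsets[OF fin] Suc.prems(2)] card_nsets[OF fin] by simp
      ultimately show ?thesis using True False by (intro exI[of _ "{A}"]) auto
    qed auto
  next
    case False
    then have "r \<le> card V - r" "H \<noteq> {}" using Suc.prems(4) by (cases Q; simp)+
    then have C': "0 < C'" by (simp add: C'_def zero_less_binomial_iff)
    \<comment> \<open>\<open>g A / C'\<close> is the matching size that is guaranteed when
      \<open>A\<close> is chosen first: one if \<open>A\<close> lies in \<open>H\<close>, plus
      \<open>Q\<close> times the density of \<open>H\<close> in the rest. Some \<open>A\<close>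
      attains the average.\<close>
    define g where "g A = C' * (if A \<in> H then 1 else 0) + Q * card {B \<in> H. A \<inter> B = {}}" for A
    have finn: "finite (nsets V r)" using finite_imp_finite_nsets[OF fin] .
    have "(\<Sum>A\<in>nsets V r. card {B \<in> H. A \<inter> B = {}}) = C' * card H"
    proof (rule sum_multicount[OF finn finH], intro ballI)
      fix B assume B: "B \<in> H"
      have "{A \<in> nsets V r. A \<inter> B = {}} = nsets (V - B) r" by (auto simp: nsets_def)
      then show "card {A \<in> nsets V r. A \<inter> B = {}} = C'"
        using HV[OF B] fin by (simp add: C'_def card_nsets card_Diff_subset)
    qed
    note s1 = this
    have s2: "(\<Sum>A\<in>nsets V r. C' * (if A \<in> H then 1 else 0)) = C' * card H"
    proof -
      have "nsets V r \<inter> H = H" using Suc.prems(2) by auto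
      then show ?thesis using finn by (simp add: sum_distrib_left[symmetric] sum.If_cases)
    qed
    have "(\<Sum>A\<in>nsets V r. g A) = (\<Sum>A\<in>nsets V r. C' * (if A \<in> H then 1 else 0))
        + Q * (\<Sum>A\<in>nsets V r. card {B \<in> H. A \<inter> B = {}})"
      by (simp add: g_def sum.distrib sum_distrib_left)
    also have "\<dots> = C' * card H + Q * (C' * card H)" by (simp only: s1 s2)
    finally have sum_g: "(\<Sum>A\<in>nsets V r. g A) = C' * (Suc Q * card H)" by (simp add: algebra_simps)
    have "\<exists>A\<in>nsets V r. C' * (Suc Q * card H) \<le> g A * C"
    proof (rule ccontr)
      assume "\<not> ?thesis"
      then have less: "g A * C < C' * (Suc Q * card H)" if "A \<in> nsets V r" for A
        using that by (auto simp: not_le)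
      have ne: "nsets V r \<noteq> {}" using \<open>H \<noteq> {}\<close> Suc.prems(2) by auto
      have "(\<Sum>A\<in>nsets V r. g A * C) < (\<Sum>A\<in>nsets V r. C' * (Suc Q * card H))"
        by (rule sum_strict_mono[OF finn ne less])
      then show False
        using sum_g by (simp add: sum_distrib_right[symmetric] card_nsets[OF fin] C_def mult.commute)
    qed
    then obtain A where A: "A \<in> nsets V r" "C' * (Suc Q * card H) \<le> g A * C" by auto
    then have A': "A \<subseteq> V" "finite A" "card A = r" by (auto simp: nsets_def)
    define HA where "HA = {B \<in> H. A \<inter> B = {}}"
    have cardVA: "card (V - A) = card V - r" using A' by (simp add: card_Diff_subset)
    have "\<exists>M\<subseteq>HA. disjoint M \<and> Q * card HA \<le> card M * (card (V - A) choose r)"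
    proof (rule Suc.IH)
      show "HA \<subseteq> nsets (V - A) r" using HV by (auto simp: HA_def nsets_def)
      show "r * Q \<le> card (V - A)" using Suc.prems(4) cardVA by simp
    qed (use fin Suc.prems in auto)
    then obtain M where M: "M \<subseteq> HA" "disjoint M" "Q * card HA \<le> card M * C'"
      unfolding cardVA C'_def by auto
    have "A \<noteq> {}" using A'(3) Suc.prems(3) by auto
    then have "A \<notin> M" using M(1) by (auto simp: HA_def)
    \<comment> \<open>The chosen \<open>A\<close> may lie outside \<open>H\<close>; then its
      vertices are simply given up.\<close>
    define M' where "M' = (if A \<in> H then insert A M else M)"
    have "finite M" using M(1) finH finite_subset[of M H] by (auto simp: HA_def)
    have "g A \<le> C' * (if A \<in> H then 1 else 0) + card M * C'"
      using M(3) unfolding g_def HA_def by (rule add_left_mono)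
    from le_trans[OF A(2) mult_le_mono1[OF this]]
    have "C' * (Suc Q * card H) \<le> (C' * (if A \<in> H then 1 else 0) + card M * C') * C" .
    also have "\<dots> = C' * (card M' * C)"
      using \<open>A \<notin> M\<close> \<open>finite M\<close> by (simp add: M'_def algebra_simps)
    finally have "Suc Q * card H \<le> card M' * C" using C' by (simp only: mult_le_cancel1)
    moreover have "M' \<subseteq> H" using M(1) by (auto simp: M'_def HA_def)
    moreover have "disjoint M'"
      using M(1,2) by (auto simp: M'_def HA_def disjoint_def)
    ultimately show ?thesis unfolding C_def by blast
  qed
qed

section \<open>Shifted families\<close>

text \<open>The guard \<open>0 < i\<close> reflects that the ground set is \<open>{1..n}\<close>.\<close>
definition shifted :: "nat set set \<Rightarrow> bool" where
  "shifted F \<longleftrightarrow> (\<forall>A\<in>F. \<forall>i j. 0 < i \<and> i < j \<and> j \<in> A \<and> i \<notin> A \<longrightarrow> insert i (A - {j}) \<in> F)"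

lemma shiftedD: "shifted F \<Longrightarrow> A \<in> F \<Longrightarrow> 0 < i \<Longrightarrow> i < j \<Longrightarrow> j \<in> A \<Longrightarrow> i \<notin> A \<Longrightarrow> insert i (A - {j}) \<in> F"
  by (auto simp: shifted_def)

lemma shifted_insertD:
  assumes "shifted F" "insert x B \<in> F" "0 < i" "i \<le> x" "x \<notin> B" "i \<notin> B"
  shows "insert i B \<in> F"
  using shiftedD[OF assms(1,2,3), of x] assms by (cases "i = x") auto

text \<open>
  Among all families of the same size with the same matching bound, one minimizing the total sum of
  the elements is shifted.
\<close>
lemma ex_shifted_family:
  assumes "F \<subseteq> nsets {1..n} k" "\<And>M. M \<subseteq> F \<Longrightarrow> disjoint M \<Longrightarrow> card M \<le> s"
  obtains F' where "F' \<subseteq> nsets {1..n} k" "card F' = card F" "shifted F'"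
    "\<And>M. M \<subseteq> F' \<Longrightarrow> disjoint M \<Longrightarrow> card M \<le> s"
proof -
  define P where "P G \<longleftrightarrow> G \<subseteq> nsets {1..n} k \<and> card G = card F
    \<and> (\<forall>M. M \<subseteq> G \<and> disjoint M \<longrightarrow> card M \<le> s)" for G
  define W :: "nat set set \<Rightarrow> nat" where "W G = (\<Sum>A\<in>G. \<Sum>A)" for G
  have "P F" using assms by (auto simp: P_def)
  then obtain G where G: "P G" and least: "\<And>G'. P G' \<Longrightarrow> W G \<le> W G'"
    using ex_has_least_nat[of P F W] by blast
  have finG: "finite G"
    using G finite_imp_finite_nsets[of "{1..n}" k] finite_subset by (auto simp: P_def)
  have GD: "A \<subseteq> {1..n}" "finite A" "card A = k" if "A \<in> G" for A
    using that G by (auto simp: P_def nsets_def)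
  have "shifted G"
  proof (rule ccontr)
    assume "\<not> shifted G"
    then obtain A0 i j where A0: "A0 \<in> G" and ij: "0 < i" "i < j"
      and A0': "j \<in> A0" "i \<notin> A0" "insert i (A0 - {j}) \<notin> G"
      by (auto simp: shifted_def)
    define \<tau> where "\<tau> x = (if x = i then j else if x = j then i else x)" for x
    have inv: "\<tau> (\<tau> x) = x" for x using ij by (auto simp: \<tau>_def)
    then have inj\<tau>: "inj \<tau>" by (metis injI)
    have inv': "\<tau> ` (\<tau> ` A) = A" for A by (simp add: image_image inv)
    have \<tau>1: "\<tau> ` A = insert i (A - {j})" if "j \<in> A" "i \<notin> A" for A
      using that ij by (auto simp: \<tau>_def image_iff)
    have \<tau>0: "\<tau> ` A = A" if "j \<notin> A" "i \<notin> A" for A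
      using that by (auto simp: \<tau>_def image_iff)
    define moved where "moved B \<longleftrightarrow> j \<in> B \<and> i \<notin> B \<and> \<tau> ` B \<notin> G" for B
    \<comment> \<open>The usual compression, with \<open>\<tau>\<close> the transposition of
      \<open>i\<close> and \<open>j\<close>. It is injective because moved sets land outside
      \<open>G\<close>.\<close>
    define \<sigma> where "\<sigma> B = (if moved B then \<tau> ` B else B)" for B
    have inj: "inj_on \<sigma> G"
    proof (rule inj_onI)
      fix A B assume "A \<in> G" "B \<in> G" "\<sigma> A = \<sigma> B"
      then show "A = B" using inj_image_eq_iff[OF inj\<tau>] by (auto simp: \<sigma>_def moved_def split: if_splits)
    qed
    have "j \<le> n" using GD(1)[OF A0] A0' by auto
    have "P (\<sigma> ` G)"
      unfolding P_def
    proof (intro conjI allI impI)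
      show "\<sigma> ` G \<subseteq> nsets {1..n} k"
      proof clarify
        fix B assume B: "B \<in> G"
        have "\<tau> ` B \<subseteq> {1..n}" using GD(1)[OF B] ij \<open>j \<le> n\<close> by (auto simp: \<tau>_def)
        moreover have "card (\<tau> ` B) = k"
          using GD(3)[OF B] card_image[OF inj_on_subset[OF inj\<tau>]] by auto
        ultimately show "\<sigma> B \<in> nsets {1..n} k" using GD[OF B] by (auto simp: \<sigma>_def nsets_def)
      qed
      show "card (\<sigma> ` G) = card F" using card_image[OF inj] G by (simp add: P_def)
      fix M assume M: "M \<subseteq> \<sigma> ` G \<and> disjoint M"
      show "card M \<le> s"
      proof (cases "M \<subseteq> G")
        case True
        then show ?thesis using M G by (auto simp: P_def)
      next
        case False
        then obtain A where A: "A \<in> M" "A \<notin> G" by auto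
        then obtain B where B: "B \<in> G" "moved B" "A = \<tau> ` B"
          using M by (auto simp: \<sigma>_def split: if_splits)
        then have "i \<in> A" using \<tau>1 by (auto simp: moved_def)
        \<comment> \<open>If \<open>M\<close> uses a new set \<open>A\<close>, applying
          \<open>\<tau>\<close> to all of \<open>M\<close> gives a matching of the same size inside
          \<open>G\<close>: \<open>A\<close> returns to its preimage, and every other member avoids
          \<open>i\<close>, so it is either fixed by \<open>\<tau>\<close> or contains
          \<open>j\<close> and was left in place only because its image already belongs to
          \<open>G\<close>.\<close>
        have "\<tau> ` C \<in> G" if C: "C \<in> M" for C
        proof (cases "C = A")
          case True
          then show ?thesis using B inv' by simp
        next
          case False
          then have "i \<notin> C" using M A(1) C \<open>i \<in> A\<close> by (auto simp: disjoint_def)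
          obtain D where D: "D \<in> G" "C = \<sigma> D" using M C by auto
          have "\<not> moved D"
          proof
            assume "moved D"
            then have "C = insert i (D - {j})" using D(2) \<tau>1[of D] by (simp add: \<sigma>_def moved_def)
            then show False using \<open>i \<notin> C\<close> by simp
          qed
          then have "C \<in> G" "\<not> moved C" using D by (auto simp: \<sigma>_def)
          then show ?thesis using \<tau>0 \<open>i \<notin> C\<close> by (cases "j \<in> C") (auto simp: moved_def)
        qed
        then have "(`) \<tau> ` M \<subseteq> G" by auto
        moreover have "disjoint ((`) \<tau> ` M)"
          using M inj\<tau> by (intro disjoint_image) (auto intro: inj_on_subset)
        ultimately have "card ((`) \<tau> ` M) \<le> s" using G by (auto simp: P_def)
        moreover have "card ((`) \<tau> ` M) = card M"
          by (rule card_image) (auto simp: inj_on_def inj_image_eq_iff[OF inj\<tau>])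
        ultimately show ?thesis by simp
      qed
    qed
    moreover have "W (\<sigma> ` G) < W G"
    proof -
      have less: "\<Sum>(\<sigma> B) < \<Sum>B" if "B \<in> G" "moved B" for B
      proof -
        have "\<Sum>B = j + \<Sum>(B - {j})" "\<Sum>(\<tau> ` B) = i + \<Sum>(B - {j})"
          using GD(2)[OF that(1)] that(2) \<tau>1 by (auto simp: moved_def sum.remove)
        then show ?thesis using ij that by (simp add: \<sigma>_def)
      qed
      have "(\<Sum>B\<in>G. \<Sum>(\<sigma> B)) < (\<Sum>B\<in>G. \<Sum>B)"
      proof (rule sum_strict_mono_ex1[OF finG])
        show "\<forall>B\<in>G. \<Sum>(\<sigma> B) \<le> \<Sum>B" using less by (auto simp: \<sigma>_def intro: less_imp_le)
        show "\<exists>B\<in>G. \<Sum>(\<sigma> B) < \<Sum>B" using less[OF A0] A0 A0' \<tau>1 by (auto simp: moved_def)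
      qed
      then show ?thesis unfolding W_def by (simp add: sum.reindex[OF inj])
    qed
    ultimately show False using least[of "\<sigma> ` G"] by simp
  qed
  then show ?thesis using that[of G] G by (auto simp: P_def)
qed

text \<open>Sets through both vertices are kept, and in the others \<open>j\<close> is replaced by
  \<open>i\<close>. This is injective, with the inverse replacement \<open>g\<close> as left
  inverse.\<close>

lemma deg_antimono:
  assumes "shifted H" "finite H" "0 < i" "i \<le> j"
  shows "deg H j \<le> deg H i"
proof (cases "i = j")
  case False
  define \<phi> where "\<phi> A = (if i \<in> A then A else insert i (A - {j}))" for A
  show ?thesis
    unfolding deg_def
  proof (rule card_inj_on_le)
    show "inj_on \<phi> {A \<in> H. j \<in> A}"
    proof (rule inj_onI)
      fix A B assume *: "A \<in> {A \<in> H. j \<in> A}" "B \<in> {A \<in> H. j \<in> A}" "\<phi> A = \<phi> B"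
      define g where "g S = (if j \<in> S then S else insert j (S - {i}))" for S :: "nat set"
      have g: "g (\<phi> A) = A" if "j \<in> A" for A
      proof (cases "i \<in> A")
        case i: False
        then have "j \<notin> \<phi> A" using False by (auto simp: \<phi>_def)
        moreover have "insert j (insert i (A - {j}) - {i}) = A" using i that False by auto
        ultimately show ?thesis using i by (simp add: \<phi>_def g_def)
      qed (use that in \<open>simp add: \<phi>_def g_def\<close>)
      have "A = g (\<phi> A)" by (rule g[symmetric]) (use *(1) in simp)
      also have "\<dots> = g (\<phi> B)" by (simp only: *(3))
      also have "\<dots> = B" by (rule g) (use *(2) in simp)
      finally show "A = B" .
    qed
    show "\<phi> ` {A \<in> H. j \<in> A} \<subseteq> {A \<in> H. i \<in> A}"
      using shiftedD[OF assms(1)] assms False by (auto simp: \<phi>_def)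
    show "finite {A \<in> H. i \<in> A}" using assms by auto
  qed
qed simp

lemma shifted_restrict: "shifted F \<Longrightarrow> shifted {A \<in> F. A \<subseteq> {1..y}}"
  unfolding shifted_def by (auto 0 3 simp: subset_iff)

text \<open>The last vertex has the smallest degree, hence at most the average
  \<open>r * card H / (z + 1)\<close>. Deleting it therefore costs at most the proportion
  \<open>r / (z + 1)\<close> of \<open>H\<close>, exactly the proportion by which the binomial
  coefficient drops.\<close>

lemma shifted_density_step:
  assumes "shifted H" "H \<subseteq> nsets {1..Suc z} r"
  shows "card H * (z choose r) \<le> card {A \<in> H. A \<subseteq> {1..z}} * (Suc z choose r)"
proof (cases "r \<le> Suc z")
  case True
  have finH: "finite H" using assms finite_imp_finite_nsets[of "{1..Suc z}" r] finite_subset by blast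
  define h where "h = card {A \<in> H. A \<subseteq> {1..z}}"
  define d where "d = deg H (Suc z)"
  have "d * Suc z \<le> (\<Sum>i\<in>{1..Suc z}. deg H i)"
    using sum_bounded_below[of "{1..Suc z}" d "deg H"] deg_antimono[OF assms(1) finH]
    by (simp add: d_def mult.commute)
  then have le: "d * Suc z \<le> r * card H" using sum_deg[OF _ assms(2)] by simp
  have "card H = h + d"
  proof -
    have "H = {A \<in> H. A \<subseteq> {1..z}} \<union> {A \<in> H. Suc z \<in> A}"
      using assms(2) by (auto simp: nsets_def atLeastAtMostSuc_conv)
    moreover have "{A \<in> H. A \<subseteq> {1..z}} \<inter> {A \<in> H. Suc z \<in> A} = {}" by auto
    ultimately show ?thesis using finH card_Un_disjoint[of "{A \<in> H. A \<subseteq> {1..z}}" "{A \<in> H. Suc z \<in> A}"]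
      by (simp add: h_def d_def deg_def)
  qed
  then have "(Suc z - r) * card H \<le> Suc z * h"
    using le by (simp add: diff_mult_distrib algebra_simps)
  then have "(Suc z - r) * card H * (Suc z choose r) \<le> Suc z * h * (Suc z choose r)" by simp
  moreover have "(Suc z - r) * (Suc z choose r) = Suc z * (z choose r)"
    using binomial_absorb_comp[of "Suc z" r] by simp
  ultimately have "Suc z * (card H * (z choose r)) \<le> Suc z * (h * (Suc z choose r))"
    by (metis (no_types, lifting) mult.assoc mult.left_commute)
  then show ?thesis unfolding h_def[symmetric] by (simp only: mult_le_cancel1)
qed (simp add: binomial_eq_0)

lemma shifted_density:
  assumes "shifted H" "H \<subseteq> nsets {1..x} r" "y \<le> x"
  shows "card H * (y choose r) \<le> card {A \<in> H. A \<subseteq> {1..y}} * (x choose r)"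
proof -
  define h where "h z = card {A \<in> H. A \<subseteq> {1..z}}" for z
  have "h z * (y choose r) \<le> h y * (z choose r)" if "y \<le> z" for z
    using that
  proof (induction z rule: dec_induct)
    case (step z)
    show ?case
    \<comment> \<open>The cross-multiplied inequalities are chained by cancelling
      \<open>z choose r\<close>; where it vanishes, so does \<open>y choose r\<close>.\<close>
    proof (cases "z choose r = 0")
      case True
      then have "y choose r = 0" using step.hyps by simp
      then show ?thesis by (simp only: mult_0_right)
    next
      case False
      have "h (Suc z) * (z choose r) \<le> h z * (Suc z choose r)"
      proof -
        have *: "{A \<in> {A \<in> H. A \<subseteq> {1..Suc z}}. A \<subseteq> {1..z}} = {A \<in> H. A \<subseteq> {1..z}}" by auto
        have "{A \<in> H. A \<subseteq> {1..Suc z}} \<subseteq> nsets {1..Suc z} r"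
          using assms(2) by (auto simp: nsets_def)
        from shifted_density_step[OF shifted_restrict[OF assms(1)] this]
        show ?thesis unfolding * h_def .
      qed
      then have "(z choose r) * (h (Suc z) * (y choose r)) \<le> (h z * (y choose r)) * (Suc z choose r)"
        using mult_le_mono1[of "h (Suc z) * (z choose r)" _ "y choose r"] by (simp add: algebra_simps)
      also have "\<dots> \<le> (h y * (z choose r)) * (Suc z choose r)"
        using step.IH by (rule mult_le_mono1)
      finally have "(z choose r) * (h (Suc z) * (y choose r)) \<le> (z choose r) * (h y * (Suc z choose r))"
        by (simp add: algebra_simps)
      then show ?thesis using False by (simp only: mult_le_cancel1)
    qed
  qed simp
  note main = this[OF assms(3)]
  have "{A \<in> H. A \<subseteq> {1..x}} = H" using assms(2) by (auto simp: nsets_def)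
  then show ?thesis using main by (simp only: h_def)
qed

text \<open>Only sets with largest element \<open>x\<close> contribute, so the ground set of the link is \<open>{1..<x}\<close>.\<close>
definition link :: "nat set set \<Rightarrow> nat \<Rightarrow> nat set set" where
  "link F x = {B. B \<subseteq> {1..<x} \<and> insert x B \<in> F}"

lemma shifted_link:
  assumes "shifted F"
  shows "shifted (link F x)"
  unfolding shifted_def
proof (intro ballI allI impI)
  fix B i j assume B: "B \<in> link F x" and ij: "0 < i \<and> i < j \<and> j \<in> B \<and> i \<notin> B"
  then have *: "B \<subseteq> {1..<x}" "insert x B \<in> F" by (auto simp: link_def)
  then have "j < x" using ij by auto
  then have "insert i (insert x B - {j}) \<in> F" using ij * by (intro shiftedD[OF assms]) auto
  moreover have "insert i (insert x B - {j}) = insert x (insert i (B - {j}))"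
    using \<open>j < x\<close> by auto
  ultimately show "insert i (B - {j}) \<in> link F x"
    using * ij \<open>j < x\<close> by (auto simp: link_def)
qed

lemma link_subset_nsets:
  assumes "F \<subseteq> nsets {1..n} k"
  shows "link F (Suc x) \<subseteq> nsets {1..x} (k - 1)"
proof
  fix B assume "B \<in> link F (Suc x)"
  then have B: "B \<subseteq> {1..<Suc x}" "insert (Suc x) B \<in> F" by (auto simp: link_def)
  then have "finite B" "Suc x \<notin> B" "card (insert (Suc x) B) = k"
    using assms by (auto simp: nsets_def intro: finite_subset)
  then show "B \<in> nsets {1..x} (k - 1)" using B by (auto simp: nsets_def)
qed

text \<open>Restricting a shifted link to \<open>{1..m}\<close> does not lower its density, and for
  sets inside \<open>{1..m}\<close> the vertex \<open>Suc x\<close> can be shifted down to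
  \<open>Suc m\<close>.\<close>

lemma card_link_le:
  assumes "shifted F" "F \<subseteq> nsets {1..n} k" "m \<le> x"
  shows "card (link F (Suc x)) * (m choose (k - 1)) \<le> card (link F (Suc m)) * (x choose (k - 1))"
proof -
  have "finite (link F (Suc m))"
    using link_subset_nsets[OF assms(2)] finite_imp_finite_nsets finite_subset by blast
  moreover have "{B \<in> link F (Suc x). B \<subseteq> {1..m}} \<subseteq> link F (Suc m)"
  proof clarify
    fix B assume B: "B \<in> link F (Suc x)" "B \<subseteq> {1..m}"
    then have "insert (Suc x) B \<in> F" by (simp add: link_def)
    then have "insert (Suc m) B \<in> F"
      by (rule shifted_insertD[OF assms(1)]) (use B assms(3) in auto)
    then show "B \<in> link F (Suc m)" using B by (auto simp: link_def)
  qed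
  ultimately have "card {B \<in> link F (Suc x). B \<subseteq> {1..m}} \<le> card (link F (Suc m))"
    by (rule card_mono)
  moreover have "card (link F (Suc x)) * (m choose (k - 1))
      \<le> card {B \<in> link F (Suc x). B \<subseteq> {1..m}} * (x choose (k - 1))"
    using shifted_density[OF shifted_link[OF assms(1)] link_subset_nsets[OF assms(2)] assms(3)] .
  ultimately show ?thesis by (auto intro: le_trans mult_le_mono1)
qed

text \<open>Sort the sets not inside \<open>{1..m}\<close> by their largest element
  \<open>x + 1\<close>. With \<open>\<beta>\<close> the density of the link of \<open>m + 1\<close>,
  there are at most \<open>\<beta>\<close> times \<open>x choose (k - 1)\<close> of them, and these
  binomials sum to \<open>(n choose k) - (m choose k)\<close>. The inequality is multiplied out to
  stay within the naturals.\<close>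

lemma card_shifted_le:
  assumes "shifted F" "F \<subseteq> nsets {1..n} k" "m \<le> n" "0 < k"
  shows "card F * (m choose (k - 1)) + card (link F (Suc m)) * (m choose k)
    \<le> card {A \<in> F. A \<subseteq> {1..m}} * (m choose (k - 1)) + card (link F (Suc m)) * (n choose k)"
proof -
  define f where "f x = card {A \<in> F. A \<subseteq> {1..x}}" for x
  define C d where "C = m choose (k - 1)" and "d = card (link F (Suc m))"
  have finF: "finite F" using assms(2) finite_imp_finite_nsets[of "{1..n}" k] finite_subset by blast
  have "f x * C + d * (m choose k) \<le> f m * C + d * (x choose k)" if "m \<le> x" for x
    using that
  proof (induction x rule: dec_induct)
    case (step x)
    have "{A \<in> F. A \<subseteq> {1..Suc x}} \<subseteq> {A \<in> F. A \<subseteq> {1..x}} \<union> insert (Suc x) ` link F (Suc x)"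
    proof
      fix A assume "A \<in> {A \<in> F. A \<subseteq> {1..Suc x}}"
      then have A: "A \<in> F" "A \<subseteq> {1..Suc x}" by auto
      show "A \<in> {A \<in> F. A \<subseteq> {1..x}} \<union> insert (Suc x) ` link F (Suc x)"
      proof (cases "Suc x \<in> A")
        case True
        then have "insert (Suc x) (A - {Suc x}) = A" by auto
        moreover have "A - {Suc x} \<subseteq> {1..<Suc x}" using A(2) by auto
        ultimately have "A - {Suc x} \<in> link F (Suc x)" using A(1) by (simp add: link_def)
        then have "insert (Suc x) (A - {Suc x}) \<in> insert (Suc x) ` link F (Suc x)" by (rule imageI)
        then show ?thesis using \<open>insert (Suc x) (A - {Suc x}) = A\<close> by simp
      next
        case False
        then show ?thesis using A by (auto simp: atLeastAtMostSuc_conv)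
      qed
    qed
    moreover have finl: "finite (link F (Suc x))"
      using link_subset_nsets[OF assms(2)] finite_imp_finite_nsets finite_subset by blast
    ultimately have "f (Suc x) \<le> card ({A \<in> F. A \<subseteq> {1..x}} \<union> insert (Suc x) ` link F (Suc x))"
      unfolding f_def using finF by (intro card_mono) auto
    also have "\<dots> \<le> f x + card (insert (Suc x) ` link F (Suc x))" unfolding f_def by (rule card_Un_le)
    also have "\<dots> \<le> f x + card (link F (Suc x))" using card_image_le[OF finl] by simp
    finally have "f (Suc x) * C \<le> (f x + card (link F (Suc x))) * C" by (rule mult_le_mono1)
    also have "\<dots> = f x * C + card (link F (Suc x)) * C" by (rule add_mult_distrib)
    also have "\<dots> \<le> f x * C + d * (x choose (k - 1))"
      using card_link_le[OF assms(1,2) step.hyps(1)] by (simp add: C_def d_def)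
    finally show ?case
      using step.IH assms(4) by (cases k) (auto simp: algebra_simps)
  qed simp
  note main = this[OF assms(3)]
  have "{A \<in> F. A \<subseteq> {1..n}} = F" using assms(2) by (auto simp: nsets_def)
  then show ?thesis using main by (simp only: f_def C_def d_def)
qed

section \<open>Estimates for binomial coefficients\<close>

text \<open>The Weierstrass product inequality.\<close>

lemma one_minus_sum_le_prod:
  fixes e :: "nat \<Rightarrow> real"
  assumes "\<And>i. i < r \<Longrightarrow> 0 \<le> e i \<and> e i \<le> 1"
  shows "1 - (\<Sum>i<r. e i) \<le> (\<Prod>i<r. 1 - e i)"
  using assms
proof (induction r)
  case (Suc r)
  have "(\<Prod>i<r. 1 - e i) \<le> 1" by (rule prod_le_1) (use Suc.prems in auto)
  then have "e r * (\<Prod>i<r. 1 - e i) \<le> e r" using Suc.prems[of r] by (simp add: mult_left_le)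
  moreover have "1 - (\<Sum>i<r. e i) \<le> (\<Prod>i<r. 1 - e i)" using Suc by simp
  ultimately show ?case by (simp add: algebra_simps)
qed simp

text \<open>Compares the two binomials factor by factor: \<open>e i\<close> is the relative loss
  conceded at the \<open>i\<close>-th factor, and the losses add up by the Weierstrass inequality.
  It is applied with \<open>c = k\<close> to count transversals and with \<open>c = 1\<close> to
  compare ground sets.\<close>

lemma binomial_ratio_ge:
  fixes c :: real and e :: "nat \<Rightarrow> real"
  assumes "r \<le> a" "r \<le> b"
    and e: "\<And>i. i < r \<Longrightarrow> 0 \<le> e i \<and> e i \<le> 1 \<and> (1 - e i) * (real b - real i) \<le> c * (real a - real i)"
  shows "(1 - (\<Sum>i<r. e i)) * real (b choose r) \<le> real (a choose r) * c ^ r"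
proof -
  have bin: "real (n choose r) = (\<Prod>i<r. (real n - real i) / real (r - i))" if "r \<le> n" for n
    unfolding binomial_altdef_of_nat[OF that] atLeast0LessThan
    by (rule prod.cong) (use that in auto)
  have "(1 - (\<Sum>i<r. e i)) * real (b choose r) \<le> (\<Prod>i<r. 1 - e i) * real (b choose r)"
    by (intro mult_right_mono one_minus_sum_le_prod) (use e in auto)
  also have "\<dots> = (\<Prod>i<r. (1 - e i) * ((real b - real i) / real (r - i)))"
    by (simp only: bin[OF assms(2)] prod.distrib)
  also have "\<dots> \<le> (\<Prod>i<r. c * ((real a - real i) / real (r - i)))"
  proof (rule prod_mono)
    fix i assume i: "i \<in> {..<r}"
    then have "0 \<le> (1 - e i) * ((real b - real i) / real (r - i))"
      using e[of i] assms(2) by (intro mult_nonneg_nonneg divide_nonneg_nonneg) auto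
    moreover have "(1 - e i) * (real b - real i) / real (r - i) \<le> c * (real a - real i) / real (r - i)"
      using e[of i] i by (intro divide_right_mono) auto
    ultimately show "0 \<le> (1 - e i) * ((real b - real i) / real (r - i)) \<and>
        (1 - e i) * ((real b - real i) / real (r - i)) \<le> c * ((real a - real i) / real (r - i))"
      by simp
  qed
  also have "\<dots> = real (a choose r) * c ^ r"
    unfolding bin[OF assms(1)] prod.distrib by (simp add: mult.commute)
  finally show ?thesis .
qed

lemma binomial_mult_diff: "0 < k \<Longrightarrow> k * (m choose k) = (m - (k - 1)) * (m choose (k - 1))"
  using times_binomial_minus1_eq[of k m] binomial_absorb_comp[of m "k - 1"] by simp

text \<open>Bounds the transversals through a vertex, when \<open>t\<close> of the \<open>N\<close>
  parts have been removed, against all \<open>k\<close>-sets of the full ground set through that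
  vertex. Dense links need \<open>t = 0\<close> only.\<close>

lemma transversal_count_ge:
  assumes "0 < k" "k + t \<le> N"
  shows "(1 - real (k - 1) * real (2 * t + k) / (2 * real N)) * real (k * N - 1 choose (k - 1))
    \<le> real ((N - t - 1 choose (k - 1)) * k ^ (k - 1))"
proof -
  define r where "r = k - 1"
  have k: "k = Suc r" using assms by (simp add: r_def)
  have rN: "r + t + 1 \<le> N" using assms k by simp
  have NkN: "N \<le> k * N" using assms by simp
  have sum: "(\<Sum>i<r. real (t + 1 + i)) = real r * real (2 * t + k) / 2"
    unfolding k by (induction r) (auto simp: field_simps)
  \<comment> \<open>The loss \<open>(t + 1 + i) / N\<close> is the one for which
    \<open>(1 - e i) * k * N\<close> equals \<open>k * (N - t - 1 - i)\<close>.\<close>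
  have "(1 - (\<Sum>i<r. real (t + 1 + i) / real N)) * real (k * N - 1 choose r)
      \<le> real (N - t - 1 choose r) * real k ^ r"
  proof (rule binomial_ratio_ge)
    show "r \<le> N - t - 1" "r \<le> k * N - 1" using rN NkN by linarith+
    fix i assume i: "i < r"
    have *: "real (t + 1 + i) \<le> real N" using i rN by linarith
    have N: "0 < real N" using rN by simp
    have "(1 - real (t + 1 + i) / real N) * (real (k * N - 1) - real i)
        \<le> (1 - real (t + 1 + i) / real N) * (real k * real N)"
    proof (rule mult_left_mono)
      have "real (k * N - 1) \<le> real (k * N)" by (rule of_nat_mono) simp
      then show "real (k * N - 1) - real i \<le> real k * real N" by simp
      show "0 \<le> 1 - real (t + 1 + i) / real N" using * N by simp
    qed
    also have "\<dots> = real k * (real (N - t - 1) - real i)"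
      using N rN by (simp add: field_simps of_nat_diff)
    finally show "0 \<le> real (t + 1 + i) / real N \<and> real (t + 1 + i) / real N \<le> 1 \<and>
        (1 - real (t + 1 + i) / real N) * (real (k * N - 1) - real i) \<le> real k * (real (N - t - 1) - real i)"
      using * N by simp
  qed
  moreover have "(\<Sum>i<r. real (t + 1 + i) / real N) = real r * real (2 * t + k) / (2 * real N)"
    unfolding sum_divide_distrib[symmetric] sum by simp
  ultimately show ?thesis unfolding r_def[symmetric] by simp
qed

lemma ground_set_ratio:
  fixes k n N :: nat
  assumes "5 \<le> k" "101 * k ^ 3 < N" "k * N \<le> n"
    and "real n < real N * (real k + 1 / (100 * real k))"
  shows "50 * k * (n choose k) \<le> (50 * k + 1) * (k * N - 1 choose k)"
proof -
  define m where "m = k * N - 1"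
  have "k * k * k = k ^ 3" by (simp add: power3_eq_cube)
  moreover have "5 * 5 * k \<le> k * k * k" using assms(1) by (intro mult_le_mono) auto
  \<comment> \<open>\<open>2525 = 101 * 5^2\<close>, from \<open>k \<ge> 5\<close>.\<close>
  ultimately have N: "2525 * k < N" using assms(2) by simp
  have NkN: "N \<le> k * N" using assms(1) by simp
  have m: "real m = real k * real N - 1" using N NkN by (simp add: m_def of_nat_diff)
  have k: "0 < real k" using assms(1) by simp
  \<comment> \<open>The relative loss at the smallest factor \<open>n - k + 1\<close>, used
    uniformly for all \<open>k\<close> factors.\<close>
  define e where "e = real (n - m) / (real n - real k + 1)"
  have nm: "real (n - m) \<le> real N / (100 * real k) + 1"
  proof -
    have "m \<le> n" using assms(3) by (simp add: m_def)
    then have "real (n - m) = real n - real m" by simp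
    also have "real n \<le> real N * (real k + 1 / (100 * real k))" using assms(4) by simp
    also have "\<dots> = real k * real N + real N / (100 * real k)" by (simp add: algebra_simps)
    finally show ?thesis using m by simp
  qed
  have den: "real k * (real N - 1) \<le> real n - real k + 1"
    using assms(3) of_nat_mono[OF assms(3), where 'a = real] by (simp add: algebra_simps)
  have pos: "0 < real k * (real N - 1)" using N k by simp
  have "real k * e \<le> 1 / (50 * real k + 1)"
  proof -
    have "real k * e \<le> real k * ((real N / (100 * real k) + 1) / (real k * (real N - 1)))"
      unfolding e_def using nm den pos k by (intro mult_left_mono frac_le) auto
    also have "\<dots> = (real N / (100 * real k) + 1) / (real N - 1)" using k by simp
    also have "\<dots> \<le> 1 / (50 * real k + 1)"
    proof -
      have "(real N / (100 * real k) + 1) * (50 * real k + 1) = real N / 2 + real N / (100 * real k) + 50 * real k + 1"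
        using k by (simp add: field_simps)
      also have "real N / (100 * real k) \<le> real N / 500" using assms(1) by (intro divide_left_mono) auto
      also have "real N / 2 + real N / 500 + 50 * real k + 1 \<le> real N - 1"
      proof -
        have "2525 * real k < real N" using N by (metis of_nat_less_iff of_nat_mult of_nat_numeral)
        then show ?thesis using assms(1) by simp
      qed
      finally show ?thesis using N k by (simp add: field_simps)
    qed
    finally show ?thesis .
  qed
  have "(1 - (\<Sum>i<k. e)) * real (n choose k) \<le> real (m choose k) * 1 ^ k"
  proof (rule binomial_ratio_ge)
    show "k \<le> m" "k \<le> n" using N NkN assms(1,3) unfolding m_def by linarith+
    then have km: "real k \<le> real m" "real k \<le> real n" by simp_all
    have mn: "m \<le> n" using assms(3) by (simp add: m_def)
    fix i assume i: "i < k"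
    have "e * (real n - real k + 1) \<le> e * (real n - real i)"
      using i km unfolding e_def by (intro mult_left_mono) auto
    moreover have "e * (real n - real k + 1) = real n - real m"
      using km mn by (simp add: e_def of_nat_diff)
    moreover have "e \<le> 1" using km mn by (simp add: e_def of_nat_diff)
    moreover have "0 \<le> e" using km by (simp add: e_def)
    ultimately show "0 \<le> e \<and> e \<le> 1 \<and> (1 - e) * (real n - real i) \<le> 1 * (real m - real i)"
      by (simp add: algebra_simps)
  qed
  then have "(1 - real k * e) * real (n choose k) \<le> real (m choose k)" by simp
  moreover have "1 - 1 / (50 * real k + 1) \<le> 1 - real k * e"
    using \<open>real k * e \<le> 1 / (50 * real k + 1)\<close> by simp
  ultimately have "(1 - 1 / (50 * real k + 1)) * real (n choose k) \<le> real (m choose k)"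
    by (meson mult_right_mono of_nat_0_le_iff order_trans)
  then have "50 * real k * real (n choose k) \<le> (50 * real k + 1) * real (m choose k)"
    using k by (simp add: field_simps)
  then have "real (50 * k * (n choose k)) \<le> real ((50 * k + 1) * (m choose k))" by (simp add: algebra_simps)
  then show ?thesis unfolding m_def using of_nat_le_iff by blast
qed

section \<open>Matchings in shifted families\<close>

lemma deg_nsets:
  assumes "finite V" "v \<in> V" "0 < k"
  shows "deg (nsets V k) v = card V - 1 choose (k - 1)"
proof -
  have "bij_betw (insert v) (nsets (V - {v}) (k - 1)) {A \<in> nsets V k. v \<in> A}"
  proof (rule bij_betwI')
    fix X Y assume "X \<in> nsets (V - {v}) (k - 1)" "Y \<in> nsets (V - {v}) (k - 1)"
    then have "v \<notin> X" "v \<notin> Y" by (auto simp: nsets_def)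
    then show "(insert v X = insert v Y) = (X = Y)" by (rule insert_ident)
  next
    fix X assume "X \<in> nsets (V - {v}) (k - 1)"
    then have "X \<subseteq> V" "v \<notin> X" "finite X" "card X = k - 1" by (auto simp: nsets_def)
    then show "insert v X \<in> {A \<in> nsets V k. v \<in> A}" using assms by (simp add: nsets_def)
  next
    fix A assume "A \<in> {A \<in> nsets V k. v \<in> A}"
    then have "A - {v} \<in> nsets (V - {v}) (k - 1)" "A = insert v (A - {v})"
      using assms by (auto simp: nsets_def)
    then show "\<exists>X\<in>nsets (V - {v}) (k - 1). A = insert v X" by blast
  qed
  note card_eq = bij_betw_same_card[OF this]
  show ?thesis unfolding deg_def card_eq[symmetric] using assms by (simp add: card_nsets)
qed

lemma deg_missing:
  assumes "finite V" "v \<in> V" "0 < k"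
  shows "deg (nsets V k - F) v + deg (F \<inter> nsets V k) v = card V - 1 choose (k - 1)"
proof -
  let ?D = "{A \<in> nsets V k. v \<in> A}"
  have "finite ?D" using finite_imp_finite_nsets[OF assms(1)] by simp
  then have "card ?D = card (?D \<inter> F) + card (?D - F)" by (rule card_Int_Diff)
  moreover have "?D \<inter> F = {A \<in> F \<inter> nsets V k. v \<in> A}" "?D - F = {A \<in> nsets V k - F. v \<in> A}" by auto
  ultimately show ?thesis using deg_nsets[OF assms] by (simp only: deg_def)
qed

text \<open>The complementary form of \<open>deg_antimono\<close>. It makes the last vertex the
  worst one and lets the vertices with many missing sets form a final segment.\<close>

lemma deg_missing_mono:
  assumes "shifted F" "0 < k" "0 < v" "v \<le> w" "w \<le> x"
  shows "deg (nsets {1..x} k - F) v \<le> deg (nsets {1..x} k - F) w"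
proof -
  have "shifted (F \<inter> nsets {1..x} k)"
    unfolding shifted_def
  proof (intro ballI allI impI)
    fix A i j assume A: "A \<in> F \<inter> nsets {1..x} k" and ij: "0 < i \<and> i < j \<and> j \<in> A \<and> i \<notin> A"
    have "insert i (A - {j}) \<in> F" using shiftedD[OF assms(1), of A i j] A ij by simp
    moreover have "insert i (A - {j}) \<subseteq> {1..x}" using A ij by (auto simp: nsets_def)
    moreover have "card (insert i (A - {j})) = k"
      using A ij card_Suc_Diff1[of A j] by (simp add: nsets_def)
    ultimately show "insert i (A - {j}) \<in> F \<inter> nsets {1..x} k"
      using A by (simp add: nsets_def)
  qed
  then have "deg (F \<inter> nsets {1..x} k) w \<le> deg (F \<inter> nsets {1..x} k) v"
    using assms finite_imp_finite_nsets[of "{1..x}" k] by (intro deg_antimono) auto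
  then show ?thesis
    using deg_missing[of "{1..x}" v k F] deg_missing[of "{1..x}" w k F] assms by simp
qed

lemma deg_last:
  assumes "F \<subseteq> nsets {1..n} k"
  shows "deg (F \<inter> nsets {1..Suc m} k) (Suc m) = card (link F (Suc m))"
proof -
  have "{A \<in> F \<inter> nsets {1..Suc m} k. Suc m \<in> A} = insert (Suc m) ` link F (Suc m)"
  proof
    show "insert (Suc m) ` link F (Suc m) \<subseteq> {A \<in> F \<inter> nsets {1..Suc m} k. Suc m \<in> A}"
      using assms by (auto simp: link_def nsets_def subset_iff)
    show "{A \<in> F \<inter> nsets {1..Suc m} k. Suc m \<in> A} \<subseteq> insert (Suc m) ` link F (Suc m)"
    proof
      fix A assume A: "A \<in> {A \<in> F \<inter> nsets {1..Suc m} k. Suc m \<in> A}"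
      have "A - {Suc m} \<subseteq> {1..<Suc m}" using A by (auto simp: nsets_def)
      moreover have "insert (Suc m) (A - {Suc m}) = A" using A by auto
      ultimately show "A \<in> insert (Suc m) ` link F (Suc m)"
        using A by (intro image_eqI[of _ _ "A - {Suc m}"]) (auto simp: link_def)
    qed
  qed
  moreover have "inj_on (insert (Suc m)) (link F (Suc m))"
    by (rule inj_onI) (metis (no_types, lifting) link_def mem_Collect_eq insert_ident
        atLeastLessThan_iff less_irrefl subsetD)
  ultimately show ?thesis unfolding deg_def by (simp add: card_image)
qed

text \<open>A family beating \<open>m choose k\<close> must make up for every missing set of
  \<open>[m]\<close> by sets reaching beyond \<open>m\<close>, and the density of the link of
  \<open>m + 1\<close> limits how many of these there are.\<close>

lemma missing_bound:
  assumes "shifted F" "F \<subseteq> nsets {1..n} k" "5 \<le> k" "101 * k ^ 3 < N" "k * N \<le> n"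
    and "real n < real N * (real k + 1 / (100 * real k))"
    and "(k * N - 1 choose k) < card F"
  shows "50 * k * card (nsets {1..k * N - 1} k - F) < card (link F (k * N)) * N"
proof -
  define m C d g where "m = k * N - 1" and "C = m choose (k - 1)" and "d = card (link F (k * N))"
    and "g = card (nsets {1..m} k - F)"
  have "0 < k * N" using assms(3,4) by simp
  then have Sm: "Suc m = k * N" by (simp add: m_def)
  have "N \<le> k * N" using assms(3) by simp
  have "k \<le> k * N" using assms(4) by simp
  then have "0 < C" using Sm unfolding C_def zero_less_binomial_iff by linarith
  have "card {A \<in> F. A \<subseteq> {1..m}} + g = m choose k"
  proof -
    have fin: "finite (nsets {1..m} k)" by (simp add: finite_imp_finite_nsets)
    have "{A \<in> F. A \<subseteq> {1..m}} = nsets {1..m} k \<inter> F" using assms(2) by (auto simp: nsets_def)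
    then have "card {A \<in> F. A \<subseteq> {1..m}} + g = card (nsets {1..m} k)"
      using card_Int_Diff[OF fin, of F] by (simp add: g_def)
    then show ?thesis by (simp add: card_nsets)
  qed
  then have "card {A \<in> F. A \<subseteq> {1..m}} + g + 1 \<le> card F" using assms(7) by (simp add: m_def)
  then have "(card {A \<in> F. A \<subseteq> {1..m}} + g + 1) * C \<le> card F * C" by (rule mult_le_mono1)
  moreover have "card F * C + d * (m choose k) \<le> card {A \<in> F. A \<subseteq> {1..m}} * C + d * (n choose k)"
  proof -
    have "m \<le> n" "0 < k" using assms(3,5) by (simp_all add: m_def)
    then show ?thesis using card_shifted_le[OF assms(1,2)] by (simp only: C_def d_def Sm[symmetric])
  qed
  ultimately have "(g + 1) * C + d * (m choose k) \<le> d * (n choose k)" by (simp add: algebra_simps)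
  then have "50 * k * ((g + 1) * C + d * (m choose k)) \<le> d * (50 * k * (n choose k))"
    using mult_le_mono2 by (metis (no_types, lifting) mult.left_commute)
  also have "\<dots> \<le> d * ((50 * k + 1) * (m choose k))"
    using ground_set_ratio[OF assms(3-6)] by (simp add: m_def)
  finally have "50 * k * (g + 1) * C \<le> d * (m choose k)" by (simp add: algebra_simps)
  then have "k * (50 * k * (g + 1) * C) \<le> d * (k * (m choose k))"
    using mult_le_mono2 by (metis (no_types, lifting) mult.left_commute)
  also have "\<dots> = d * ((m - (k - 1)) * C)"
    using binomial_mult_diff[of k m] assms(3) by (simp add: C_def)
  also have "\<dots> \<le> d * (k * N * C)" by (intro mult_le_mono2 mult_le_mono1) (use Sm in linarith)
  finally have "(k * C) * (50 * k * (g + 1)) \<le> (k * C) * (d * N)" by (simp add: algebra_simps)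
  \<comment> \<open>The \<open>+ 1\<close> stems from the strict excess of \<open>card F\<close>. It
    gives a strict bound even for \<open>g = 0\<close>, and thereby a nonempty link.\<close>
  then have "50 * k * (g + 1) \<le> d * N" using \<open>0 < C\<close> assms(3) by (simp only: mult_le_cancel1) simp
  then show ?thesis using assms(3) unfolding g_def d_def m_def by simp
qed

text \<open>In a balanced partition of \<open>[k N]\<close> a part has missing degree at most
  \<open>C - d\<close> plus the average \<open>1 / N\<close> of the total. The deficit
  \<open>d\<close> has to pay for this average and for the shortfall of the transversal
  count.\<close>

lemma matching_dense_link:
  assumes "shifted F" "F \<subseteq> nsets {1..n} k" "5 \<le> k" "101 * k ^ 3 < N"
    and g: "50 * k * card (nsets {1..k * N - 1} k - F) < card (link F (k * N)) * N"
    and dense: "k\<^sup>2 * (k * N - 1 choose (k - 1)) \<le> card (link F (k * N)) * N"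
  shows "\<exists>M\<subseteq>F. disjoint M \<and> card M = N"
proof -
  define C d where "C = k * N - 1 choose (k - 1)" and "d = card (link F (k * N))"
  define g where "g = card (nsets {1..k * N - 1} k - F)"
  define V where "V = {1..k * N}"
  define u where "u = deg (nsets V k - F)"
  have N: "0 < N" "0 < k" using assms(3,4) by simp_all
  then have Sm: "Suc (k * N - 1) = k * N" by simp
  have "k \<le> N" using assms(3,4) self_le_power[of k 3] by simp
  have "N \<le> k * N" using N by simp
  have "0 < C" using \<open>k \<le> N\<close> \<open>N \<le> k * N\<close> unfolding C_def zero_less_binomial_iff by linarith
  have V: "finite V" "card V = k * N" by (auto simp: V_def)
  have last: "u (k * N) + d = C"
    using deg_missing[of V "k * N" k F] deg_last[OF assms(2), of "k * N - 1"] N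
    by (simp add: V_def u_def C_def d_def Sm)
  have u: "u v \<le> C - d" if "v \<in> V" for v
    using deg_missing_mono[OF assms(1), of k v "k * N" "k * N"] that N last by (simp add: V_def u_def)
  have "(\<Sum>v\<in>V. u v) = k * card (nsets V k - F)"
    unfolding u_def by (rule sum_deg) (auto simp: V_def)
  also have "\<dots> \<le> k * (g + (C - d))"
  proof (rule mult_le_mono2)
    have "nsets V k - F \<subseteq> (nsets {1..k * N - 1} k - F) \<union> {A \<in> nsets V k - F. k * N \<in> A}"
    proof
      fix A assume A: "A \<in> nsets V k - F"
      show "A \<in> (nsets {1..k * N - 1} k - F) \<union> {A \<in> nsets V k - F. k * N \<in> A}"
      proof (cases "k * N \<in> A")
        case False
        have "x \<le> k * N - 1" if "x \<in> A" for x
        proof -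
          have "x \<le> k * N" "x \<noteq> k * N" using A that False by (auto simp: nsets_def V_def)
          then show ?thesis by simp
        qed
        then show ?thesis using A by (auto simp: nsets_def V_def)
      qed (use A in auto)
    qed
    then have "card (nsets V k - F) \<le> card ((nsets {1..k * N - 1} k - F) \<union> {A \<in> nsets V k - F. k * N \<in> A})"
      using finite_imp_finite_nsets[OF V(1)] finite_imp_finite_nsets[of "{1..k * N - 1}" k]
      by (intro card_mono) auto
    also have "\<dots> \<le> g + u (k * N)" unfolding g_def u_def deg_def by (rule card_Un_le)
    finally show "card (nsets V k - F) \<le> g + (C - d)" using last by simp
  qed
  finally have sum: "(\<Sum>v\<in>V. u v) \<le> k * (g + (C - d))" .
  obtain P where P: "partition_on V P" "\<forall>S\<in>P. card S = k"
    "\<forall>S\<in>P. N * (\<Sum>x\<in>S. u x) \<le> N * (C - d) + (\<Sum>x\<in>V. u x)"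
    using balanced_partition[OF V N(2,1), of u "C - d", OF u] by blast
  have "\<exists>P'. partition_on V P' \<and> (\<forall>E\<in>P'. card E = k) \<and> P' \<subseteq> F"
  proof (rule perfect_matching_by_switching[OF V(1) P(1,2) V(2)], rule ballI)
    fix S assume S: "S \<in> P - F"
    define K where "K = (N - 1 choose (k - 1)) * k ^ (k - 1)"
    define z where "z = (\<Sum>x\<in>S. u x)"
    have "z < K"
    proof (rule ccontr)
      assume "\<not> z < K"
      then have "N * K \<le> N * z" by simp
      also have "\<dots> \<le> N * (C - d) + k * (g + (C - d))"
        using P(3) S sum unfolding z_def by (meson DiffD1 add_left_mono le_trans)
      finally have "real (N * K) \<le> real (N * (C - d) + k * (g + (C - d)))" by (rule of_nat_mono)
      then have "real N * real K \<le> real N * real (C - d) + real k * (real g + real (C - d))"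
        by (simp only: of_nat_add of_nat_mult)
      moreover have "real (C - d) = real C - real d" using last by simp
      ultimately have "real N * real K \<le> real N * (real C - real d) + real k * (real g + (real C - real d))"
        by (simp only:)
      then have up: "real N * real K \<le> real N * real C - real d * real N + real k * real g
          + real k * real C - real k * real d" by (simp add: algebra_simps)
      have "(1 - real (k - 1) * real k / (2 * real N)) * real C \<le> real K"
        using transversal_count_ge[of k 0 N] N \<open>k \<le> N\<close> by (simp add: C_def K_def)
      then have "2 * real N * ((1 - real (k - 1) * real k / (2 * real N)) * real C) \<le> 2 * real N * real K"
        by (intro mult_left_mono) auto
      moreover have "2 * real N * ((1 - real (k - 1) * real k / (2 * real N)) * real C)
          = 2 * (real N * real C) - (real k)\<^sup>2 * real C + real k * real C"
        using N by (simp add: field_simps power2_eq_square of_nat_diff)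
      ultimately have low: "2 * (real N * real C) - (real k)\<^sup>2 * real C + real k * real C \<le> 2 * (real N * real K)"
        by simp
      have "real (50 * k * g) < real (d * N)" using g unfolding g_def d_def by (simp only: of_nat_less_iff)
      then have g': "50 * (real k * real g) < real d * real N" by simp
      have "real (k\<^sup>2 * C) \<le> real (d * N)" using dense unfolding C_def d_def by (simp only: of_nat_le_iff)
      then have dense': "(real k)\<^sup>2 * real C \<le> real d * real N" by simp
      have "5 * real k \<le> (real k)\<^sup>2" using assms(3) by (simp add: power2_eq_square)
      then have "5 * real k * real C \<le> (real k)\<^sup>2 * real C" by (rule mult_right_mono) simp
      moreover have "0 < real k * real C" using N \<open>0 < C\<close> by simp
      moreover have "0 \<le> real k * real d" by simp
      \<comment> \<open>Together \<open>up\<close> and \<open>low\<close> give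
        \<open>2 d N \<le> k^2 C + k C + 2 k g\<close>, but the terms on the right are at most
        \<open>d N\<close>, \<open>d N / 5\<close> and \<open>d N / 25\<close>.\<close>
      ultimately show False using up low g' dense' by argo
    qed
    then show "(\<Sum>x\<in>S. deg (nsets V k - F) x) < (N - 1 choose (k - 1)) * k ^ (k - 1)"
      by (simp add: z_def K_def u_def)
  qed
  then obtain P' where P': "partition_on V P'" "\<forall>E\<in>P'. card E = k" "P' \<subseteq> F" by auto
  have "card P' = N" using card_uniform_partition[OF V(1) P'(1,2) V(2)] N by simp
  then show ?thesis using P'(3) partition_onD2[OF P'(1)] by blast
qed

text \<open>
  For a small link the error term of \<open>transversal_count_ge\<close> is too large for the last vertices,
  so those missing at least half of the possible sets are matched beforehand through the link.
\<close>
lemma matching_sparse_link: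
  assumes "shifted F" "F \<subseteq> nsets {1..n} k" "5 \<le> k" "101 * k ^ 3 < N"
    and g: "50 * k * card (nsets {1..k * N - 1} k - F) < card (link F (k * N)) * N"
    and sparse: "card (link F (k * N)) * N < k\<^sup>2 * (k * N - 1 choose (k - 1))"
  shows "\<exists>M\<subseteq>F. disjoint M \<and> card M = N"
proof -
  define C d m where "C = k * N - 1 choose (k - 1)" and "d = card (link F (k * N))" and "m = k * N - 1"
  define g where "g = card (nsets {1..m} k - F)"
  define u where "u = deg (nsets {1..m} k - F)"
  have N: "0 < N" "0 < k" using assms(3,4) by simp_all
  have Sm: "Suc m = k * N" using N by (simp add: m_def)
  have "k ^ 3 = k\<^sup>2 * k" by (simp add: eval_nat_numeral)
  moreover have "k\<^sup>2 * 5 \<le> k\<^sup>2 * k" using assms(3) by (rule mult_le_mono2)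
  ultimately have Nk2: "505 * k\<^sup>2 < N" using assms(4) by linarith
  have k2: "5 * k \<le> k\<^sup>2" using assms(3) by (simp add: power2_eq_square)
  have NkN: "N \<le> k * N" "5 * N \<le> k * N" using assms(3) by simp_all
  have C0: "0 < C" using Nk2 k2 NkN N unfolding C_def zero_less_binomial_iff by linarith
  have sparse': "d * N < k\<^sup>2 * C" using sparse by (simp only: d_def C_def)
  have gd: "50 * (k * g) < d * N" using g by (simp add: g_def d_def m_def mult.assoc)
  have sum_u: "(\<Sum>v\<in>{1..m}. u v) = k * g"
    unfolding u_def g_def by (rule sum_deg) auto
  \<comment> \<open>The missing degrees in \<open>[m]\<close> sum to \<open>k g < d N / 50\<close>,
    so fewer than \<open>d N / (25 C)\<close> vertices can have missing degree \<open>C / 2\<close>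
    or more; \<open>t\<close> bounds their number.\<close>
  define t where "t = (d * N) div (25 * C)"
  have t1: "t * (25 * C) \<le> d * N" unfolding t_def by (rule div_times_less_eq_dividend)
  have t2: "d * N < (t + 1) * (25 * C)"
    using dividend_less_times_div[of "25 * C" "d * N"] C0 unfolding t_def by (simp add: algebra_simps)
  have tk: "25 * t < k\<^sup>2"
  proof -
    have "(25 * t) * C = t * (25 * C)" by simp
    also note le_less_trans[OF t1 sparse']
    finally show ?thesis by simp
  qed
  \<comment> \<open>The vertices to be covered through the link are the last \<open>t\<close> of
    \<open>[m]\<close> and \<open>k N\<close> itself, hence \<open>t + 1\<close> in all.\<close>
  define q where "q = m - t"
  have q: "q + t + 1 = k * N" "N \<le> q + 1" using tk Nk2 NkN Sm unfolding q_def by linarith+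
  have light: "2 * u v < C" if v: "v \<in> {1..q}" for v
  proof (rule ccontr)
    assume "\<not> 2 * u v < C"
    then have ge: "C \<le> 2 * u w" if "w \<in> {v..m}" for w
      using deg_missing_mono[OF assms(1), of k v w m] that v N by (simp add: u_def)
    have "(t + 1) * C \<le> card {v..m} * C" using v q Sm by (intro mult_le_mono1) auto
    also have "\<dots> \<le> (\<Sum>w\<in>{v..m}. 2 * u w)" using sum_bounded_below[of "{v..m}" C "\<lambda>w. 2 * u w"] ge by simp
    also have "\<dots> \<le> (\<Sum>w\<in>{1..m}. 2 * u w)" using v by (intro sum_mono2) auto
    also have "\<dots> = 2 * (k * g)" by (simp only: sum_distrib_left[symmetric] sum_u)
    finally show False using gd t2 by simp
  qed
  define H where "H = {B \<in> link F (k * N). B \<subseteq> {1..q}}"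
  have linkn: "link F (k * N) \<subseteq> nsets {1..m} (k - 1)"
    using link_subset_nsets[OF assms(2), of m] by (simp add: Sm)
  have Hn: "H \<subseteq> nsets {1..q} (k - 1)" using linkn by (auto simp: H_def nsets_def)
  have dens: "d * (q choose (k - 1)) \<le> card H * C"
    using shifted_density[OF shifted_link[OF assms(1)] linkn, of q]
    by (simp add: d_def H_def C_def m_def q_def)
  \<comment> \<open>There is room for \<open>N - 1\<close> disjoint \<open>(k - 1)\<close>-sets in
    \<open>{1..q}\<close>, and \<open>H\<close> has density at least \<open>d / C\<close> there, so
    \<open>M\<close> has at least \<open>(N - 1) d / C\<close> members.\<close>
  have "\<exists>M\<subseteq>H. disjoint M \<and> (N - 1) * card H \<le> card M * (card {1..q} choose (k - 1))"
  proof (rule matching_ge_density[OF _ Hn])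
    have "(k - 1) * (N - 1) + (k + N) = k * N + 1" using N by (cases k; cases N) auto
    then show "(k - 1) * (N - 1) \<le> card {1..q}" using q tk Nk2 assms(3) by simp
  qed (use assms(3) in auto)
  then obtain M where M: "M \<subseteq> H" "disjoint M" "(N - 1) * card H \<le> card M * (q choose (k - 1))" by auto
  have "(N - 1) * (d * (q choose (k - 1))) \<le> (N - 1) * (card H * C)"
    using dens by (rule mult_le_mono2)
  also have "\<dots> = (N - 1) * card H * C" by simp
  also have "\<dots> \<le> card M * (q choose (k - 1)) * C" using M(3) by (rule mult_le_mono1)
  finally have "(N - 1) * (d * (q choose (k - 1))) \<le> card M * (q choose (k - 1)) * C" .
  then have "(q choose (k - 1)) * ((N - 1) * d) \<le> (q choose (k - 1)) * (card M * C)"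
    by (simp add: mult_ac)
  moreover have "0 < (q choose (k - 1))"
    using q Nk2 k2 unfolding zero_less_binomial_iff by linarith
  ultimately have cM: "(N - 1) * d \<le> card M * C" by (simp only: mult_le_cancel1)
  \<comment> \<open>For \<open>t = 0\<close> this needs only a nonempty link; for
    \<open>t \<ge> 1\<close> the bound \<open>2 * t\<close> suffices.\<close>
  have "t + 1 \<le> card M"
  proof -
    have "0 < d" using gd by (cases d) auto
    then have "0 < (N - 1) * d" using Nk2 k2 assms(3) by simp
    then have "1 \<le> card M" using cM by (cases "card M") auto
    moreover have "2 * t \<le> card M"
    proof -
      have "2 * (t * (25 * C)) \<le> 2 * (d * N)" using t1 by (rule mult_le_mono2)
      also have "\<dots> \<le> 25 * ((N - 1) * d)"
        using N Nk2 k2 assms(3) by (cases N) (auto simp: algebra_simps)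
      also have "\<dots> \<le> 25 * (card M * C)" using cM by simp
      finally have "(25 * C) * (2 * t) \<le> (25 * C) * card M" by (simp add: mult_ac)
      then show ?thesis using C0 by simp
    qed
    ultimately show ?thesis by linarith
  qed
  then obtain M1 where M1: "M1 \<subseteq> M" "card M1 = t + 1" by (rule obtain_subset_with_card_n)
  have finM1: "finite M1" by (rule card_ge_0_finite) (simp add: M1(2))
  have M1H: "B \<subseteq> {1..q}" "finite B" "card B = k - 1" "insert (k * N) B \<in> F" if "B \<in> M1" for B
  proof -
    have "B \<in> H" using that M1(1) M(1) by auto
    moreover from this have "B \<in> nsets {1..q} (k - 1)" using Hn by auto
    ultimately show "B \<subseteq> {1..q}" "finite B" "card B = k - 1" "insert (k * N) B \<in> F"
      by (simp_all add: H_def link_def nsets_def)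
  qed
  have disj1: "B \<inter> B' = {}" if "B \<in> M1" "B' \<in> M1" "B \<noteq> B'" for B B'
    using that M1(1) M(2) by (auto simp: disjoint_def)
  have "card {q + 1..k * N} = card M1" using q M1(2) by simp
  \<comment> \<open>Any bijection will do: each link set lies in \<open>{1..q}\<close> and forms a
    member of \<open>F\<close> with \<open>k * N\<close>, which can be shifted down to any vertex
    beyond \<open>q\<close>.\<close>
  then obtain \<tau> where \<tau>: "bij_betw \<tau> M1 {q + 1..k * N}"
    using finite_same_card_bij[OF finM1] by (metis finite_atLeastAtMost)
  have \<tau>q: "\<tau> B \<in> {q + 1..k * N}" if "B \<in> M1" for B using \<tau> that by (auto simp: bij_betw_def)
  have inj\<tau>: "B = B'" if "\<tau> B = \<tau> B'" "B \<in> M1" "B' \<in> M1" for B B'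
    using \<tau> that by (auto simp: bij_betw_def inj_on_def)
  define M2 where "M2 = (\<lambda>B. insert (\<tau> B) B) ` M1"
  have M2F: "M2 \<subseteq> F"
  proof
    fix A assume "A \<in> M2"
    then obtain B where B: "B \<in> M1" "A = insert (\<tau> B) B" by (auto simp: M2_def)
    have "k * N \<notin> B" "\<tau> B \<notin> B" using M1H(1)[OF B(1)] \<tau>q[OF B(1)] q by auto
    then show "A \<in> F"
      using shifted_insertD[OF assms(1) M1H(4)[OF B(1)], of "\<tau> B"] \<tau>q[OF B(1)] B(2) by simp
  qed
  have inter: "insert (\<tau> B) B \<inter> insert (\<tau> B') B' = {}" if B: "B \<in> M1" "B' \<in> M1" "B \<noteq> B'" for B B'
  proof -
    have "\<tau> B \<noteq> \<tau> B'" using inj\<tau>[OF _ B(1,2)] B(3) by blast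
    moreover have "\<tau> B \<notin> B'" using \<tau>q[OF B(1)] M1H(1)[OF B(2)] by auto
    moreover have "\<tau> B' \<notin> B" using \<tau>q[OF B(2)] M1H(1)[OF B(1)] by auto
    ultimately show ?thesis using disj1[OF B] by simp
  qed
  have M2d: "disjoint M2"
  proof (rule disjointI)
    fix A A' assume "A \<in> M2" "A' \<in> M2" "A \<noteq> A'"
    then obtain B B' where "B \<in> M1" "B' \<in> M1" "B \<noteq> B'" "A = insert (\<tau> B) B" "A' = insert (\<tau> B') B'"
      by (auto simp: M2_def)
    then show "A \<inter> A' = {}" using inter by simp
  qed
  have M2c: "card M2 = t + 1"
  proof -
    have "inj_on (\<lambda>B. insert (\<tau> B) B) M1"
    proof (rule inj_onI, rule ccontr)
      fix B B' assume *: "B \<in> M1" "B' \<in> M1" "insert (\<tau> B) B = insert (\<tau> B') B'" "B \<noteq> B'"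
      show False using inter[OF *(1,2,4)] *(3) by simp
    qed
    then show ?thesis using M1(2) by (simp add: M2_def card_image)
  qed
  \<comment> \<open>All remaining vertices are light, and as \<open>t + 1\<close> sets of size
    \<open>k\<close> were removed from \<open>[k N]\<close>, the rest has \<open>k * N'\<close>
    elements.\<close>
  define V where "V = {1..q} - \<Union>M1"
  define N' where "N' = N - (t + 1)"
  have tN: "t + 1 + k\<^sup>2 \<le> N" "k + (t + 1) \<le> N" using tk Nk2 k2 by linarith+
  have finV: "finite V" by (simp add: V_def)
  have cardV: "card V = k * N'"
  proof -
    have "card (\<Union>M1) = (\<Sum>B\<in>M1. card B)"
      using M1H(2) disj1 by (intro card_Union_disjoint) (auto simp: disjoint_def)
    also have "\<dots> = (t + 1) * (k - 1)" using M1H(3) M1(2) by simp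
    finally have "card (\<Union>M1) = (t + 1) * (k - 1)" .
    moreover have "\<Union>M1 \<subseteq> {1..q}" using M1H(1) by blast
    ultimately have "card V = q - (t + 1) * (k - 1)"
      unfolding V_def using finM1 M1H(2) by (subst card_Diff_subset) auto
    moreover have "k * N' = k * N - k * (t + 1)" by (simp add: N'_def diff_mult_distrib2)
    moreover have "(t + 1) * (k - 1) + (t + 1) = k * (t + 1)" using N by (cases k) auto
    ultimately show ?thesis using q(1) by linarith
  qed
  define u' where "u' = deg (nsets V k - F)"
  have Vq: "V \<subseteq> {1..q}" "V \<subseteq> {1..m}" using q Sm by (auto simp: V_def)
  have sub: "nsets V k - F \<subseteq> nsets {1..m} k - F" using nsets_mono[OF Vq(2)] by blast
  have finm: "finite (nsets {1..m} k - F)" by (simp add: finite_imp_finite_nsets)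
  have u': "u' v \<le> C div 2" if "v \<in> V" for v
  proof -
    have "u' v \<le> u v"
      unfolding u'_def u_def using sub finm by (rule deg_mono)
    then show ?thesis using light[of v] that Vq(1) by auto
  qed
  have sum_u': "(\<Sum>v\<in>V. u' v) \<le> k * g"
  proof -
    have "(\<Sum>v\<in>V. u' v) = k * card (nsets V k - F)"
      unfolding u'_def by (rule sum_deg) (auto simp: V_def)
    then show ?thesis using card_mono[OF finm sub] by (simp add: g_def)
  qed
  have N': "0 < N'" "k\<^sup>2 \<le> N'" using tN N by (auto simp: N'_def)
  obtain P where P: "partition_on V P" "\<forall>S\<in>P. card S = k"
    "\<forall>S\<in>P. N' * (\<Sum>x\<in>S. u' x) \<le> N' * (C div 2) + (\<Sum>x\<in>V. u' x)"
    using balanced_partition[OF finV cardV N(2) N'(1), of u' "C div 2", OF u'] by blast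
  have "\<exists>P'. partition_on V P' \<and> (\<forall>E\<in>P'. card E = k) \<and> P' \<subseteq> F"
  proof (rule perfect_matching_by_switching[OF finV P(1,2) cardV], rule ballI)
    fix S assume S: "S \<in> P - F"
    define K where "K = (N' - 1 choose (k - 1)) * k ^ (k - 1)"
    define z where "z = (\<Sum>x\<in>S. u' x)"
    have "z < K"
    proof (rule ccontr)
      assume "\<not> z < K"
      then have "N' * K \<le> N' * z" by simp
      also have "N' * z \<le> N' * (C div 2) + k * g"
        using P(3) S sum_u' unfolding z_def by (meson DiffD1 add_left_mono le_trans)
      finally have "real (2 * (N' * K)) \<le> real (N' * (2 * (C div 2)) + 2 * (k * g))"
        by (intro of_nat_mono) simp
      also have "\<dots> \<le> real (N' * C + 2 * (k * g))"
        by (intro of_nat_mono add_mono mult_le_mono2) auto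
      finally have up: "2 * (real N' * real K) \<le> real N' * real C + 2 * (real k * real g)" by simp
      have "real (50 * (k * g)) < real (k\<^sup>2 * C)"
        using gd sparse unfolding C_def d_def of_nat_less_iff by linarith
      then have g': "50 * (real k * real g) < (real k)\<^sup>2 * real C" by simp
      \<comment> \<open>The transversals of the smaller partition are still measured against
        \<open>C\<close>, the full degree in \<open>[k N]\<close>. Since
        \<open>t < k^2 / 25\<close>, the error is of order \<open>k^3 / N\<close>, below
        \<open>1 / 4\<close>.\<close>
      have "(1 - real (k - 1) * real (2 * (t + 1) + k) / (2 * real N)) * real C \<le> real K"
        using transversal_count_ge[of k "t + 1" N] N tN by (simp add: C_def K_def N'_def)
      moreover have "real (k - 1) * real (2 * (t + 1) + k) / (2 * real N) \<le> 1 / 4"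
      proof -
        have "2 * (t + 1) + k \<le> k\<^sup>2" using tk k2 assms(3) by simp
        then have "(k - 1) * (2 * (t + 1) + k) \<le> k * k\<^sup>2" by (intro mult_le_mono) auto
        also have "\<dots> = k ^ 3" by (simp add: eval_nat_numeral)
        finally have "4 * ((k - 1) * (2 * (t + 1) + k)) \<le> 2 * N" using assms(4) by simp
        then have "real (4 * ((k - 1) * (2 * (t + 1) + k))) \<le> real (2 * N)" by (rule of_nat_mono)
        then have "4 * (real (k - 1) * real (2 * (t + 1) + k)) \<le> 2 * real N"
          by (simp only: of_nat_mult of_nat_numeral)
        moreover have "x / (2 * real N) \<le> 1 / 4" if "4 * x \<le> 2 * real N" for x
          using that N by (simp add: field_simps)
        ultimately show ?thesis by blast
      qed
      then have "(3 / 4) * real C \<le> (1 - real (k - 1) * real (2 * (t + 1) + k) / (2 * real N)) * real C"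
        by (intro mult_right_mono) auto
      ultimately have "3 / 4 * real C \<le> real K" by linarith
      then have low: "real N' * (3 / 4 * real C) \<le> real N' * real K" by (rule mult_left_mono) simp
      have "real (k\<^sup>2) \<le> real N'" using N'(2) by (rule of_nat_mono)
      then have "(real k)\<^sup>2 * real C \<le> real N' * real C" by (intro mult_right_mono) auto
      moreover have "0 < real N' * real C" using N' C0 by simp
      \<comment> \<open>\<open>K \<ge> 3 C / 4\<close> and \<open>up\<close> would give
        \<open>N' C / 2 \<le> 2 k g\<close>, whereas
        \<open>2 k g < k^2 C / 25 \<le> N' C / 25\<close>.\<close>
      ultimately show False using up g' low by argo
    qed
    then show "(\<Sum>x\<in>S. deg (nsets V k - F) x) < (N' - 1 choose (k - 1)) * k ^ (k - 1)"
      by (simp add: z_def K_def u'_def)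
  qed
  then obtain P' where P': "partition_on V P'" "\<forall>E\<in>P'. card E = k" "P' \<subseteq> F" by auto
  have cP': "card P' = N'" using card_uniform_partition[OF finV P'(1,2) cardV] N by simp
  have sep: "A \<inter> V = {}" if A: "A \<in> M2" for A
  proof -
    obtain B where B: "B \<in> M1" "A = insert (\<tau> B) B" using A by (auto simp: M2_def)
    then show ?thesis using \<tau>q[OF B(1)] by (auto simp: V_def)
  qed
  have PV: "\<Union>P' = V" using partition_onD1[OF P'(1)] by simp
  have "disjoint (M2 \<union> P')"
    using M2d partition_onD2[OF P'(1)] sep PV by (intro disjoint_union) blast+
  moreover have "M2 \<inter> P' = {}"
  proof (rule ccontr)
    assume "M2 \<inter> P' \<noteq> {}"
    then obtain A where A: "A \<in> M2" "A \<in> P'" by auto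
    then have "A = {}" using sep[OF A(1)] PV by blast
    then show False using A(2) partition_onD3[OF P'(1)] by simp
  qed
  then have "card (M2 \<union> P') = N"
    using M2c cP' tN finM1 finite_elements[OF finV P'(1)]
    by (subst card_Un_disjoint) (auto simp: M2_def N'_def)
  ultimately show ?thesis using M2F P'(3) by (intro exI[of _ "M2 \<union> P'"]) auto
qed

lemma card_le_matching_number:
  assumes "finite F" "M \<subseteq> F" "disjoint M"
  shows "card M \<le> matching_number F"
proof -
  have "{card M |M. M \<subseteq> F \<and> disjoint M} = card ` {M \<in> Pow F. disjoint M}" by auto
  then have "finite {card M |M. M \<subseteq> F \<and> disjoint M}" using assms(1) by simp
  then show ?thesis unfolding matching_number_def using assms(2,3) by (intro Max_ge) auto
qed

theorem theorem1p2:
  fixes s k n :: nat and F :: "nat set set"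
  assumes "s > k" and "k \<ge> 5"
    and "s > 101 * k ^ 3"
    and "(s + 1) * k \<le> n"
    and "real n < (real s + 1) * (real k + 1 / (100 * real k))"
    and "F \<subseteq> nsets {1..n} k"
    and "matching_number F \<le> s"
  shows "card F \<le> card (nsets {1..(s + 1) * k - 1} k)
       \<and> card F \<le> ((s + 1) * k - 1) choose k"
proof -
  have "card F \<le> k * (s + 1) - 1 choose k"
  proof (rule ccontr)
    assume large: "\<not> card F \<le> k * (s + 1) - 1 choose k"
    have "finite F"
      using assms(6) finite_imp_finite_nsets[of "{1..n}" k] finite_subset by blast
    then have "card M \<le> s" if "M \<subseteq> F" "disjoint M" for M
      using card_le_matching_number[OF _ that] assms(7) by linarith
    then obtain F' where F': "F' \<subseteq> nsets {1..n} k" "card F' = card F" "shifted F'"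
      and no_matching: "\<And>M. M \<subseteq> F' \<Longrightarrow> disjoint M \<Longrightarrow> card M \<le> s"
      using ex_shifted_family[OF assms(6)] by metis
    have N: "101 * k ^ 3 < s + 1" using assms(3) by simp
    have "50 * k * card (nsets {1..k * (s + 1) - 1} k - F') < card (link F' (k * (s + 1))) * (s + 1)"
      by (rule missing_bound[OF F'(3,1) assms(2) N])
        (use assms(4,5) large F'(2) in \<open>simp_all add: mult.commute add.commute\<close>)
    then obtain M where M: "M \<subseteq> F'" "disjoint M" "card M = s + 1"
      using matching_dense_link[OF F'(3,1) assms(2) N] matching_sparse_link[OF F'(3,1) assms(2) N]
      by (meson linorder_not_less)
    show False using no_matching[OF M(1,2)] M(3) by simp
  qed
  then show ?thesis by (simp add: card_nsets mult.commute)
qed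

end
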